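(* For every odd non-prime integer $n$ with $9\le n\le 2500$ there exists a nut graph of order $n$ with $(o_v,o_e)=(2,3)$, that is, a nut graph of order $n$ whose automorphism group has exactly two orbits on the vertex set and exactly three orbits on the edge set.
   Context: A nut graph is a finite simple graph whose adjacency matrix has a one-dimensional null space spanned by a vector with no zero entries. For a graph $\Gamma$, $o_v$ and $o_e$ denote the numbers of orbits of $\mathrm{Aut}(\Gamma)$ on the vertex set and on the edge set of $\Gamma$, respectively. *)

theory Defs
  imports
    "HOL-Combinatorics.Permutations"
    "HOL-Computational_Algebra.Primes"
    "HOL-Algebra.Group_Action"
    "Jordan_Normal_Form.Matrix_Kernel"
begin

text \<open>A finite simple graph of order \<open>n\<close> is represented with vertex set \<open>{0..<n}\<close> and a set \<open>E\<close> of
  undirected edges, so that its adjacency matrix is an \<open>n \<times> n\<close> matrix in the sense of the library.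
  Up to isomorphism this covers all finite simple graphs.\<close>

definition simple_graph :: "nat \<Rightarrow> nat set set \<Rightarrow> bool" where
  "simple_graph n E \<longleftrightarrow> (\<forall>e\<in>E. e \<subseteq> {0..<n} \<and> card e = 2)"

definition adjacency_matrix :: "nat \<Rightarrow> nat set set \<Rightarrow> real mat" where
  "adjacency_matrix n E = mat n n (\<lambda>(i, j). if {i, j} \<in> E then 1 else 0)"

definition nut_graph :: "nat \<Rightarrow> nat set set \<Rightarrow> bool" where
  "nut_graph n E \<longleftrightarrow>
     simple_graph n E \<and>
     kernel_dim (adjacency_matrix n E) = 1 \<and>
     (\<exists>x \<in> mat_kernel (adjacency_matrix n E).
        mat_kernel (adjacency_matrix n E) =
          LinearCombinations.module.span class_ring (module_vec TYPE(real) n) {x} \<and>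
        (\<forall>i<n. x $ i \<noteq> 0))"

definition Aut :: "nat \<Rightarrow> nat set set \<Rightarrow> (nat \<Rightarrow> nat) monoid" where
  "Aut n E =
     \<lparr> carrier = {p. p permutes {0..<n} \<and>
                      (\<forall>u\<in>{0..<n}. \<forall>v\<in>{0..<n}. {p u, p v} \<in> E \<longleftrightarrow> {u, v} \<in> E)},
       mult = (\<circ>), one = id \<rparr>"

text \<open>The restrictions below do not affect the orbits; they make the maps actions in the sense of
  \<^locale>\<open>group_action\<close>, which asks for extensional bijections.\<close>

definition vertex_orbits :: "nat \<Rightarrow> nat set set \<Rightarrow> nat set set" where
  "vertex_orbits n E = orbits (Aut n E) {0..<n} (\<lambda>p. restrict p {0..<n})"

definition edge_orbits :: "nat \<Rightarrow> nat set set \<Rightarrow> nat set set set" where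
  "edge_orbits n E = orbits (Aut n E) E (\<lambda>p. \<lambda>e\<in>E. p ` e)"

end

theory Submission
  imports Defs
begin

text \<open>
  In a graph with two vertex orbits, a nonzero kernel vector that is constant on the orbits exists exactly
  when the \<open>2 \<times> 2\<close> quotient matrix is singular. The idea is to build such graphs from pieces so symmetric
  that the orbits are evident, and so simple that nothing else lies in the kernel.

  Let \<open>R\<close> be a relation of degree \<open>r\<close> on \<open>m\<close> points, such as a cycle of odd length, and let \<open>S\<close> and
  \<open>T\<close> be relations of degrees \<open>s\<close> and \<open>t\<close> on \<open>a\<close> and \<open>b\<close> points, all symmetric, arc-transitive and
  nonsingular as matrices. Put the tensor product \<open>R \<otimes> S\<close> on one set of \<open>m a\<close> vertices and
  \<open>R \<otimes> T\<close> on another set of \<open>m b\<close> vertices, and join two vertices of different sets whenever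
  they lie over the same point of \<open>R\<close> (locale \<open>layered_join\<close>). The quotient matrix is
  \<open>(r s, b; a, r t)\<close>, so the numerical condition is \<open>r s r t = a b\<close>. Under it the kernel is
  one-dimensional: summing a kernel vector over the fibres gives a function on the base which is
  harmonic for two-step walks, hence constant, and then nonsingularity of the tensor
  products determines the vector (lemma \<open>kernel_multiple\<close>). The automorphisms of the three pieces
  permute each of the three kinds of edges transitively, and the two vertex orbits have
  different degrees. A variant replaces \<open>R \<otimes> S\<close> by copies of \<open>S\<close>, with condition \<open>s r t = a b\<close>; for
  a single edge \<open>S\<close> and \<open>b = 1\<close> this hangs one triangle on each vertex of a cycle.

  The order is \<open>m (a + b)\<close>. With cycles as base, a solution of \<open>4 s t = a b\<close> (or \<open>2 s t = a b\<close> in the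
  variant) settles all proper odd multiples of \<open>a + b\<close>. Tensor products of complete graphs, identities,
  Kneser graphs of pairs, the \<open>4 \<times> 4\<close> rook's graph and the cubic residue circulant modulo 19 give
  solutions for 26 primes \<open>a + b\<close> (lemma \<open>multipliers\<close>). A composite odd number up to 2500 has a factor
  \<open>1 < d \<le> 50\<close> with cofactor at least \<open>d\<close>; the only such odd \<open>d\<close> not divisible by one of these primes
  are 17 and 23, and what then remains is a dozen products, for which bases of larger degree are used.
\<close>

section \<open>Nonsingular arc-transitive relations\<close>

definition nbrs :: "'a set \<Rightarrow> ('a \<Rightarrow> 'a \<Rightarrow> bool) \<Rightarrow> 'a \<Rightarrow> 'a set" where
  "nbrs V S u = {w \<in> V. S u w}"

definition automorphisms :: "'a set \<Rightarrow> ('a \<Rightarrow> 'a \<Rightarrow> bool) \<Rightarrow> ('a \<Rightarrow> 'a) set" where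
  "automorphisms V S = {g. bij_betw g V V \<and> (\<forall>u\<in>V. \<forall>w\<in>V. S (g u) (g w) \<longleftrightarrow> S u w)}"

text \<open>The building blocks. The relation may have loops: its only use is as a symmetric 0/1 matrix,
  and the identity matrix is one of the blocks. Arc-transitivity concerns ordered pairs, which is
  what makes the property survive tensor products: independent motions of two related pairs move a
  pair of pairs.\<close>

locale arc_nonsingular =
  fixes V :: "'a set" and S :: "'a \<Rightarrow> 'a \<Rightarrow> bool" and d :: nat
  assumes fin: "finite V" and nonempty: "V \<noteq> {}" and pos: "d > 0"
    and sym: "\<lbrakk>u \<in> V; w \<in> V; S u w\<rbrakk> \<Longrightarrow> S w u"
    and deg: "u \<in> V \<Longrightarrow> card (nbrs V S u) = d"
    and nonsing: "\<lbrakk>\<And>v. v \<in> V \<Longrightarrow> (\<Sum>w\<in>nbrs V S v. x w) = (0::real); u \<in> V\<rbrakk> \<Longrightarrow> x u = 0"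
    and arc: "\<lbrakk>u \<in> V; w \<in> V; S u w; u' \<in> V; w' \<in> V; S u' w'\<rbrakk>
      \<Longrightarrow> \<exists>g\<in>automorphisms V S. g u = u' \<and> g w = w'"
begin

lemma finite_nbrs: "finite (nbrs V S u)"
  using fin by (simp add: nbrs_def)

lemma neighbour: assumes "u \<in> V" obtains w where "w \<in> V" "S u w"
proof -
  have "nbrs V S u \<noteq> {}" using deg[OF assms] pos by auto
  then show ?thesis using that by (auto simp: nbrs_def)
qed

lemma vertex_transitive:
  assumes "u \<in> V" "u' \<in> V" shows "\<exists>g\<in>automorphisms V S. g u = u'"
  using neighbour[OF assms(1)] neighbour[OF assms(2)] arc assms by metis

lemma sum_sum_nbrs:
  fixes x :: "'a \<Rightarrow> real"
  shows "(\<Sum>u\<in>V. \<Sum>w\<in>nbrs V S u. x w) = real d * (\<Sum>w\<in>V. x w)"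
proof -
  have "(\<Sum>u\<in>V. \<Sum>w\<in>nbrs V S u. x w) = (\<Sum>u\<in>V. \<Sum>w\<in>V. if S u w then x w else 0)"
    using fin by (simp only: nbrs_def sum.inter_filter)
  also have "\<dots> = (\<Sum>w\<in>V. \<Sum>u\<in>V. if S u w then x w else 0)" by (rule sum.swap)
  also have "\<dots> = (\<Sum>w\<in>V. \<Sum>u\<in>nbrs V S w. x w)"
  proof (rule sum.cong[OF refl])
    fix w assume w: "w \<in> V"
    have "nbrs V S w = {u \<in> V. S u w}" using sym w by (auto simp: nbrs_def)
    then show "(\<Sum>u\<in>V. if S u w then x w else 0) = (\<Sum>u\<in>nbrs V S w. x w)"
      using fin by (simp only: sum.inter_filter)
  qed
  also have "\<dots> = real d * (\<Sum>w\<in>V. x w)"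
    by (simp add: deg sum_distrib_left)
  finally show ?thesis .
qed

text \<open>Over a nonsingular regular relation the only preimage of a constant vector is the constant
  one that regularity provides. This is how a kernel vector of the final graph is seen to be constant
  on each orbit.\<close>

lemma constant_image:
  fixes x :: "'a \<Rightarrow> real"
  assumes "\<And>v. v \<in> V \<Longrightarrow> (\<Sum>w\<in>nbrs V S v. x w) = real d * c" and "u \<in> V"
  shows "x u = c"
proof -
  have "(\<lambda>w. x w - c) u = 0"
    by (rule nonsing) (use assms in \<open>simp_all add: sum_subtractf deg\<close>)
  then show ?thesis by simp
qed

text \<open>Used to replace vertex sets of arbitrary type by sets of natural numbers, over which one can
  quantify existentially.\<close>

lemma transport:
  assumes g: "bij_betw g W V"
  shows "arc_nonsingular W (\<lambda>p q. S (g p) (g q)) d" (is "arc_nonsingular W ?S d")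
proof -
  let ?h = "inv_into W g"
  have h: "bij_betw ?h V W" by (rule bij_betw_inv_into[OF g])
  have gV: "g p \<in> V" if "p \<in> W" for p using g that by (auto simp: bij_betw_def)
  have hW: "?h v \<in> W" if "v \<in> V" for v using h that by (auto simp: bij_betw_def)
  have gh: "g (?h v) = v" if "v \<in> V" for v using g that by (simp add: bij_betw_inv_into_right)
  have hg: "?h (g p) = p" if "p \<in> W" for p using g that by (simp add: bij_betw_inv_into_left)
  have nb: "bij_betw ?h (nbrs V S (g p)) (nbrs W ?S p)" if "p \<in> W" for p
    by (rule bij_betwI[where g = g]) (auto simp: nbrs_def gV hW gh hg)
  show ?thesis
  proof
    show "finite W" using g fin bij_betw_finite by blast
    show "W \<noteq> {}" using g nonempty by (auto simp: bij_betw_def)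
    show "d > 0" by (rule pos)
    show "?S q p" if "p \<in> W" "q \<in> W" "?S p q" for p q using that sym gV by blast
    show "card (nbrs W ?S p) = d" if "p \<in> W" for p
      using bij_betw_same_card[OF nb[OF that]] deg[OF gV[OF that]] by simp
    show "x p = 0" if x: "\<And>q. q \<in> W \<Longrightarrow> (\<Sum>w\<in>nbrs W ?S q. x w) = (0::real)" and p: "p \<in> W" for x p
    proof -
      have "(x \<circ> ?h) (g p) = 0"
      proof (rule nonsing)
        show "g p \<in> V" by (rule gV[OF p])
        fix v assume v: "v \<in> V"
        have "(\<Sum>w\<in>nbrs V S v. (x \<circ> ?h) w) = (\<Sum>w\<in>nbrs W ?S (?h v). x w)"
          using sum.reindex_bij_betw[OF nb[OF hW[OF v]], of x] gh[OF v] by simp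
        then show "(\<Sum>w\<in>nbrs V S v. (x \<circ> ?h) w) = 0" using x hW[OF v] by simp
      qed
      then show ?thesis using hg[OF p] by simp
    qed
    show "\<exists>k\<in>automorphisms W ?S. k p = p' \<and> k q = q'"
      if pq: "p \<in> W" "q \<in> W" "?S p q" "p' \<in> W" "q' \<in> W" "?S p' q'" for p q p' q'
    proof -
      obtain k where k: "k \<in> automorphisms V S" "k (g p) = g p'" "k (g q) = g q'"
        using arc[of "g p" "g q" "g p'" "g q'"] gV pq by blast
      have kV: "k v \<in> V" if "v \<in> V" for v using k(1) that by (auto simp: automorphisms_def bij_betw_def)
      have "bij_betw (?h \<circ> (k \<circ> g)) W W"
        using bij_betw_trans[OF bij_betw_trans[OF g] h] k(1) by (auto simp: automorphisms_def)
      moreover have "?S ((?h \<circ> (k \<circ> g)) u) ((?h \<circ> (k \<circ> g)) w) \<longleftrightarrow> ?S u w" if "u \<in> W" "w \<in> W" for u w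
        using that k(1) by (simp add: gh kV gV automorphisms_def)
      ultimately have "?h \<circ> (k \<circ> g) \<in> automorphisms W ?S" by (auto simp: automorphisms_def)
      then show ?thesis
        by (rule bexI[rotated]) (simp add: k(2,3) hg pq)
    qed
  qed
qed

end

lemma automorphisms_comp:
  assumes "g \<in> automorphisms V S" "h \<in> automorphisms V S"
  shows "g \<circ> h \<in> automorphisms V S"
proof -
  have "h u \<in> V" if "u \<in> V" for u using assms(2) that by (auto simp: automorphisms_def bij_betw_def)
  then show ?thesis using assms bij_betw_trans[of h V V g V] by (simp add: automorphisms_def)
qed

lemma automorphisms_product:
  assumes "g \<in> automorphisms V S" "h \<in> automorphisms W T"
  shows "map_prod g h \<in> automorphisms (V \<times> W) (\<lambda>p q. S (fst p) (fst q) \<and> T (snd p) (snd q))"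
  using assms by (auto simp: automorphisms_def intro!: bij_betw_map_prod)

text \<open>The tensor product of two nonsingular matrices is nonsingular: annihilate along one
  coordinate first, then along the other.\<close>

lemma arc_nonsingular_product:
  assumes "arc_nonsingular V S d" "arc_nonsingular W T e"
  shows "arc_nonsingular (V \<times> W) (\<lambda>p q. S (fst p) (fst q) \<and> T (snd p) (snd q)) (d * e)"
    (is "arc_nonsingular _ ?P _")
proof -
  interpret S: arc_nonsingular V S d by fact
  interpret T: arc_nonsingular W T e by fact
  have nb: "nbrs (V \<times> W) ?P p = nbrs V S (fst p) \<times> nbrs W T (snd p)" for p
    by (auto simp: nbrs_def)
  show ?thesis
  proof
    show "finite (V \<times> W)" "V \<times> W \<noteq> {}" "d * e > 0"
      using S.fin T.fin S.nonempty T.nonempty S.pos T.pos by auto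
    show "?P q p" if "p \<in> V \<times> W" "q \<in> V \<times> W" "?P p q" for p q
      using that S.sym T.sym by auto
    show "card (nbrs (V \<times> W) ?P p) = d * e" if "p \<in> V \<times> W" for p
      using that S.deg T.deg by (auto simp: nb card_cartesian_product)
    show "x p = 0" if x: "\<And>q. q \<in> V \<times> W \<Longrightarrow> (\<Sum>r\<in>nbrs (V \<times> W) ?P q. x r) = (0::real)"
      and p: "p \<in> V \<times> W" for x p
    proof -
      have row: "(\<Sum>w\<in>nbrs W T t. x (v, w)) = 0" if "v \<in> V" "t \<in> W" for v t
      proof (rule S.nonsing[OF _ that(1)])
        fix u assume "u \<in> V"
        then show "(\<Sum>v\<in>nbrs V S u. \<Sum>w\<in>nbrs W T t. x (v, w)) = 0"
          using x[of "(u, t)"] that by (simp add: nb sum.cartesian_product)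
      qed
      have "x (fst p, snd p) = 0"
        by (rule T.nonsing[where x = "\<lambda>w. x (fst p, w)"]) (use row p in auto)
      then show ?thesis by simp
    qed
    show "\<exists>k\<in>automorphisms (V \<times> W) ?P. k p = p' \<and> k q = q'"
      if pq: "p \<in> V \<times> W" "q \<in> V \<times> W" "?P p q" "p' \<in> V \<times> W" "q' \<in> V \<times> W" "?P p' q'" for p q p' q'
    proof -
      obtain g where g: "g \<in> automorphisms V S" "g (fst p) = fst p'" "g (fst q) = fst q'"
        using S.arc[of "fst p" "fst q" "fst p'" "fst q'"] pq by auto
      obtain h where h: "h \<in> automorphisms W T" "h (snd p) = snd p'" "h (snd q) = snd q'"
        using T.arc[of "snd p" "snd q" "snd p'" "snd q'"] pq by auto
      show ?thesis
        by (rule bexI[OF _ automorphisms_product[OF g(1) h(1)]])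
          (use g h in \<open>simp add: prod_eq_iff\<close>)
    qed
  qed
qed

lemma extend_bijection:
  assumes "finite V" "A \<subseteq> V" "inj_on f A" "f ` A \<subseteq> V"
  shows "\<exists>g. bij_betw g V V \<and> (\<forall>x\<in>A. g x = f x)"
proof -
  have "card (V - A) = card (V - f ` A)"
    using assms by (simp add: card_Diff_subset finite_subset card_image)
  then obtain h where h: "bij_betw h (V - A) (V - f ` A)"
    using finite_same_card_bij[of "V - A" "V - f ` A"] assms(1) by auto
  let ?g = "\<lambda>x. if x \<in> A then f x else h x"
  have "bij_betw ?g (A \<union> (V - A)) (f ` A \<union> (V - f ` A))"
  proof (rule bij_betw_combine)
    show "bij_betw ?g A (f ` A)"
      using assms(3) by (auto simp: bij_betw_def inj_on_def)
    show "bij_betw ?g (V - A) (V - f ` A)"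
      using h by (rule bij_betw_cong[THEN iffD1, rotated]) simp
  qed auto
  moreover have "A \<union> (V - A) = V" "f ` A \<union> (V - f ` A) = V" using assms by auto
  ultimately have "bij_betw ?g V V" by simp
  then show ?thesis by (intro exI[of _ ?g]) simp
qed

lemma identity_arc_nonsingular:
  assumes "finite V" "V \<noteq> {}"
  shows "arc_nonsingular V (=) 1"
proof
  have nb: "nbrs V (=) v = {v}" if "v \<in> V" for v using that by (auto simp: nbrs_def)
  show "finite V" "V \<noteq> {}" "(1::nat) > 0" by (simp_all add: assms)
  show "card (nbrs V (=) v) = 1" if "v \<in> V" for v using nb[OF that] by simp
  show "x u = 0" if "\<And>v. v \<in> V \<Longrightarrow> (\<Sum>w\<in>nbrs V (=) v. x w) = (0::real)" "u \<in> V" for x u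
    using that nb by fastforce
  show "\<exists>g\<in>automorphisms V (=). g u = u' \<and> g w = w'"
    if "u \<in> V" "w \<in> V" "u = w" "u' \<in> V" "w' \<in> V" "u' = w'" for u w u' w'
  proof -
    have "\<exists>g. bij_betw g V V \<and> (\<forall>x\<in>{u}. g x = u')"
      by (rule extend_bijection) (use assms that in auto)
    then show ?thesis using that by (fastforce simp: automorphisms_def bij_betw_def inj_on_eq_iff)
  qed
qed auto

text \<open>A kernel vector takes the value of its own total sum everywhere, so the sum equals
  \<open>card V\<close> times itself and vanishes.\<close>

lemma complete_arc_nonsingular:
  assumes "finite V" "card V \<ge> 2"
  shows "arc_nonsingular V (\<noteq>) (card V - 1)"
proof
  have nb: "nbrs V (\<noteq>) v = V - {v}" for v by (auto simp: nbrs_def)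
  show "finite V" "V \<noteq> {}" "card V - 1 > 0" using assms by auto
  show "card (nbrs V (\<noteq>) v) = card V - 1" if "v \<in> V" for v using that assms nb by simp
  show "x u = 0" if x: "\<And>v. v \<in> V \<Longrightarrow> (\<Sum>w\<in>nbrs V (\<noteq>) v. x w) = (0::real)" and u: "u \<in> V" for x u
  proof -
    have eq: "x v = sum x V" if "v \<in> V" for v
      using x[OF that] sum.remove[OF assms(1) that, of x] by (simp add: nb)
    then have "sum x V = real (card V) * sum x V" by (metis sum_constant sum.cong)
    then have "sum x V = 0" using assms(2) by simp
    then show ?thesis using eq[OF u] by simp
  qed
  show "\<exists>g\<in>automorphisms V (\<noteq>). g u = u' \<and> g w = w'"
    if "u \<in> V" "w \<in> V" "u \<noteq> w" "u' \<in> V" "w' \<in> V" "u' \<noteq> w'" for u w u' w'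
  proof -
    have "\<exists>g. bij_betw g V V \<and> (\<forall>v\<in>{u, w}. g v = (if v = u then u' else w'))"
      by (rule extend_bijection) (use assms that in \<open>auto simp: inj_on_def\<close>)
    then show ?thesis using that by (fastforce simp: automorphisms_def bij_betw_def inj_on_eq_iff)
  qed
qed auto

section \<open>Harmonic functions and circulants\<close>

text \<open>Maximum principle for walks of length two. Steps are taken in pairs because the kernel equations of
  the final graph relate the two orbits alternately; that two-step walks connect everything rules
  out a bipartite sign change.\<close>

lemma (in arc_nonsingular) harmonic_constant:
  fixes X :: "'a \<Rightarrow> real"
  assumes harm: "\<And>i. i \<in> V \<Longrightarrow> (\<Sum>j\<in>nbrs V S i. \<Sum>k\<in>nbrs V S j. X k) = real (d * d) * X i"
    and conn: "\<And>i j. \<lbrakk>i \<in> V; j \<in> V\<rbrakk> \<Longrightarrow> (\<lambda>i k. \<exists>j\<in>nbrs V S i. k \<in> nbrs V S j)\<^sup>*\<^sup>* i j"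
    and "i \<in> V" "j \<in> V"
  shows "X i = X j"
proof -
  define c where "c = Max (X ` V)"
  have le: "X i \<le> c" if "i \<in> V" for i using fin that by (simp add: c_def)
  have "c \<in> X ` V" unfolding c_def using fin nonempty by (intro Max_in) auto
  then obtain m where m: "m \<in> V" "X m = c" by auto
  have nV: "j \<in> V" if "j \<in> nbrs V S i" for i j using that by (simp add: nbrs_def)
  have max_step: "X k = c" if "i \<in> V" "X i = c" "j \<in> nbrs V S i" "k \<in> nbrs V S j" for i j k
  proof -
    have "(\<Sum>j\<in>nbrs V S i. \<Sum>k\<in>nbrs V S j. c - X k)
      = (\<Sum>j\<in>nbrs V S i. real d * c - (\<Sum>k\<in>nbrs V S j. X k))"
      by (rule sum.cong[OF refl]) (simp add: sum_subtractf deg[OF nV])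
    also have "\<dots> = 0" using harm[OF that(1)] that(2) deg[OF that(1)] by (simp add: sum_subtractf)
    finally have z: "(\<Sum>j\<in>nbrs V S i. \<Sum>k\<in>nbrs V S j. c - X k) = 0" .
    have le': "X k \<le> c" if "k \<in> nbrs V S j" for j k by (rule le[OF nV[OF that]])
    have "\<forall>j\<in>nbrs V S i. (\<Sum>k\<in>nbrs V S j. c - X k) = 0"
      using z by (subst (asm) sum_nonneg_eq_0_iff) (simp_all add: finite_nbrs sum_nonneg le')
    then have "(\<Sum>k\<in>nbrs V S j. c - X k) = 0" using that(3) by blast
    then have "\<forall>k\<in>nbrs V S j. c - X k = 0"
      by (subst (asm) sum_nonneg_eq_0_iff) (simp_all add: finite_nbrs le')
    then show ?thesis using that(4) by simp
  qed
  have all: "X v = c" if "v \<in> V" for v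
  proof -
    have "v \<in> V \<and> X v = c" using conn[OF m(1) that]
    proof (induction rule: rtranclp_induct)
      case base then show ?case using m by simp
    next
      case (step u w)
      then obtain j where j: "j \<in> nbrs V S u" "w \<in> nbrs V S j" by auto
      show ?case using max_step[OF _ _ j] nV[OF j(2)] step.IH by simp
    qed
    then show ?thesis ..
  qed
  then show ?thesis using assms by simp
qed

definition circulant :: "int \<Rightarrow> int set \<Rightarrow> int \<Rightarrow> int \<Rightarrow> bool" where
  "circulant m H i j \<longleftrightarrow> (j - i) mod m \<in> H"

lemma periodic_multiple:
  fixes y :: "int \<Rightarrow> 'a" assumes "\<And>i. y (i + m) = y i" shows "y (i + m * c) = y i"
proof (induction c arbitrary: i rule: int_induct[where k = 0])
  case (step1 c)
  show ?case using step1.IH[of i] assms[of "i + m * c"] by (simp add: algebra_simps)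
next
  case (step2 c)
  show ?case using step2.IH[of i] assms[of "i + m * (c - 1)"] by (simp add: algebra_simps)
qed simp

lemma mod_affine:
  fixes m :: int
  shows "(c + d * (a mod m - b)) mod m = (c + d * (a - b)) mod m"
    and "(c + d * (a mod m)) mod m = (c + d * a) mod m"
  by (rule mod_add_cong[OF refl mod_mult_cong[OF refl mod_diff_cong[OF mod_mod_trivial refl]]])
    (rule mod_add_cong[OF refl mod_mult_cong[OF refl mod_mod_trivial]])

text \<open>When the connection set is a group of units modulo \<open>m\<close>, the affine maps with multiplier in
  that group act transitively on arcs; containing \<open>-1\<close> makes the relation symmetric.\<close>

locale circulant_group =
  fixes m :: int and H :: "int set"
  assumes m: "m > 1" and H_sub: "H \<subseteq> {0..<m}" and one: "1 \<in> H" and minus_one: "m - 1 \<in> H"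
    and mult: "\<lbrakk>x \<in> H; y \<in> H\<rbrakk> \<Longrightarrow> (x * y) mod m \<in> H"
    and inverse: "x \<in> H \<Longrightarrow> \<exists>y\<in>H. (x * y) mod m = 1"
begin

lemma H_mod: "x \<in> H \<Longrightarrow> x mod m = x" using H_sub by auto

lemma finite_H: "finite H" using H_sub finite_subset by blast

lemma bij_nbrs:
  assumes "v \<in> {0..<m}"
  shows "bij_betw (\<lambda>h. (v + h) mod m) H (nbrs {0..<m} (circulant m H) v)"
proof (rule bij_betwI[where g = "\<lambda>w. (w - v) mod m"])
  show "(\<lambda>h. (v + h) mod m) \<in> H \<rightarrow> nbrs {0..<m} (circulant m H) v"
    using m by (auto simp: nbrs_def circulant_def mod_simps H_mod)
  show "(\<lambda>w. (w - v) mod m) \<in> nbrs {0..<m} (circulant m H) v \<rightarrow> H"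
    by (auto simp: nbrs_def circulant_def)
qed (auto simp: mod_simps H_mod nbrs_def)

lemma affine_automorphism:
  assumes v: "v \<in> {0..<m}" "v' \<in> {0..<m}" and k: "k \<in> H"
  shows "(\<lambda>x. (v' + k * (x - v)) mod m) \<in> automorphisms {0..<m} (circulant m H)"
proof -
  obtain k' where k': "k' \<in> H" "(k * k') mod m = 1" using inverse[OF k] by auto
  have kk: "(k' * (k * x)) mod m = x mod m" "(k * (k' * x)) mod m = x mod m" for x
  proof -
    have "(k * k' * x) mod m = ((k * k') mod m * x) mod m" by (simp add: mod_simps)
    then have "(k * k' * x) mod m = x mod m" using k' by simp
    then show "(k' * (k * x)) mod m = x mod m" "(k * (k' * x)) mod m = x mod m"
      by (simp_all add: ac_simps)
  qed
  have inv: "(v + k' * ((v' + k * (x - v)) mod m - v')) mod m = x"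
    "(v' + k * ((v + k' * (x - v')) mod m - v)) mod m = x" if "x \<in> {0..<m}" for x
  proof -
    have "(v + k' * ((v' + k * (x - v)) mod m - v')) mod m = (v + (k' * (k * (x - v))) mod m) mod m"
      by (simp add: mod_affine mod_add_right_eq)
    also have "\<dots> = x" using that by (simp add: kk mod_simps)
    finally show "(v + k' * ((v' + k * (x - v)) mod m - v')) mod m = x" .
    have "(v' + k * ((v + k' * (x - v')) mod m - v)) mod m = (v' + (k * (k' * (x - v'))) mod m) mod m"
      by (simp add: mod_affine mod_add_right_eq)
    also have "\<dots> = x" using that by (simp add: kk mod_simps)
    finally show "(v' + k * ((v + k' * (x - v')) mod m - v)) mod m = x" .
  qed
  have "bij_betw (\<lambda>x. (v' + k * (x - v)) mod m) {0..<m} {0..<m}"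
    by (rule bij_betwI[where g = "\<lambda>x. (v + k' * (x - v')) mod m"]) (use m inv in auto)
  moreover have "circulant m H ((v' + k * (x - v)) mod m) ((v' + k * (y - v)) mod m) \<longleftrightarrow> circulant m H x y"
    for x y
  proof -
    have "((v' + k * (y - v)) mod m - (v' + k * (x - v)) mod m) mod m = (k * (y - x)) mod m"
      unfolding mod_diff_eq by (rule arg_cong[where f = "\<lambda>x. x mod m"]) (simp add: algebra_simps)
    moreover have "(k * (y - x)) mod m \<in> H \<longleftrightarrow> (y - x) mod m \<in> H"
    proof
      assume "(k * (y - x)) mod m \<in> H"
      from mult[OF k'(1) this] show "(y - x) mod m \<in> H" by (simp add: mod_simps kk)
    next
      assume "(y - x) mod m \<in> H"
      from mult[OF k this] show "(k * (y - x)) mod m \<in> H" by (simp add: mod_simps)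
    qed
    ultimately show ?thesis by (simp add: circulant_def)
  qed
  ultimately show ?thesis by (simp add: automorphisms_def)
qed

text \<open>Nonsingularity is stated for periodic functions on all integers, where translations
  are available without reduction.\<close>

lemma arc_nonsingular:
  assumes nonsing: "\<And>y i. \<lbrakk>\<And>i. y (i + m) = y i; \<And>i. (\<Sum>h\<in>H. y (i + h)) = (0::real)\<rbrakk> \<Longrightarrow> y i = 0"
  shows "arc_nonsingular {0..<m} (circulant m H) (card H)"
proof
  show "finite {0..<m}" "{0..<m} \<noteq> {}" using m by auto
  show "card H > 0" using one finite_H by (auto simp: card_gt_0_iff)
  show "circulant m H w u" if "circulant m H u w" for u w
  proof -
    have "(m - 1) * (w - u) = u - w + m * (w - u)" by (simp add: algebra_simps)
    then have "((m - 1) * ((w - u) mod m)) mod m = (u - w + m * (w - u)) mod m"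
      by (simp only: mod_mult_right_eq)
    then have "((m - 1) * ((w - u) mod m)) mod m = (u - w) mod m" by simp
    then show ?thesis using mult[OF minus_one that[unfolded circulant_def]] by (simp add: circulant_def)
  qed
  show "card (nbrs {0..<m} (circulant m H) u) = card H" if "u \<in> {0..<m}" for u
    using bij_betw_same_card[OF bij_nbrs[OF that]] by simp
  show "x u = 0" if x: "\<And>v. v \<in> {0..<m} \<Longrightarrow> (\<Sum>w\<in>nbrs {0..<m} (circulant m H) v. x w) = (0::real)"
    and u: "u \<in> {0..<m}" for x u
  proof -
    have "x (u mod m) = 0"
    proof (rule nonsing[where y = "\<lambda>i. x (i mod m)"])
      show "x ((i + m) mod m) = x (i mod m)" for i by simp
      show "(\<Sum>h\<in>H. x ((i + h) mod m)) = 0" for i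
      proof -
        have i: "i mod m \<in> {0..<m}" using m by auto
        have "(\<Sum>h\<in>H. x ((i mod m + h) mod m)) = (\<Sum>w\<in>nbrs {0..<m} (circulant m H) (i mod m). x w)"
          by (rule sum.reindex_bij_betw[OF bij_nbrs[OF i]])
        then show ?thesis using x[OF i] by (simp add: mod_simps)
      qed
    qed
    then show ?thesis using u by simp
  qed
  show "\<exists>g\<in>automorphisms {0..<m} (circulant m H). g u = u' \<and> g w = w'"
    if "u \<in> {0..<m}" "w \<in> {0..<m}" "circulant m H u w" "u' \<in> {0..<m}" "w' \<in> {0..<m}" "circulant m H u' w'"
    for u w u' w'
  proof -
    define a b where "a = (w - u) mod m" and "b = (w' - u') mod m"
    have ab: "a \<in> H" "b \<in> H" using that by (auto simp: circulant_def a_def b_def)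
    obtain a' where a': "a' \<in> H" "(a * a') mod m = 1" using inverse[OF ab(1)] by auto
    define k where "k = (b * a') mod m"
    have k: "k \<in> H" unfolding k_def by (rule mult[OF ab(2) a'(1)])
    have "(u' + k * (w - u)) mod m = (u' + b * a' * (w - u)) mod m"
      unfolding k_def by (rule mod_add_cong[OF refl mod_mult_cong[OF mod_mod_trivial refl]])
    also have "b * a' * (w - u) = b * ((w - u) * a')" by (simp add: ac_simps)
    also have "(u' + b * ((w - u) * a')) mod m = (u' + b * ((a * a') mod m)) mod m"
      unfolding a_def by (simp only: mod_mult_left_eq mod_affine(2))
    also have "\<dots> = w'" using that a' by (simp add: b_def mod_simps)
    finally have "(u' + k * (w - u)) mod m = w'" .
    then show ?thesis using that
      by (intro bexI[OF _ affine_automorphism[OF that(1,4) k]]) simp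
  qed
qed

text \<open>Two steps along \<open>1\<close> advance by \<open>2\<close>, and \<open>2\<close> generates the integers modulo
  an odd \<open>m\<close>.\<close>

lemma two_step_connected:
  assumes "odd m" "i \<in> {0..<m}" "j \<in> {0..<m}"
  shows "(\<lambda>i k. \<exists>j\<in>nbrs {0..<m} (circulant m H) i. k \<in> nbrs {0..<m} (circulant m H) j)\<^sup>*\<^sup>* i j"
    (is "?W\<^sup>*\<^sup>* i j")
proof -
  have step: "?W v ((v + 2) mod m)" if "v \<in> {0..<m}" for v
    using m one that
    by (intro bexI[of _ "(v + 1) mod m"]) (auto simp: nbrs_def circulant_def mod_simps)
  have walk: "?W\<^sup>*\<^sup>* i ((i + 2 * int t) mod m)" for t
  proof (induction t)
    case 0
    then show ?case using assms by simp
  next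
    case (Suc t)
    have "?W ((i + 2 * int t) mod m) (((i + 2 * int t) mod m + 2) mod m)"
      by (rule step) (use m in auto)
    then have "?W ((i + 2 * int t) mod m) ((i + 2 * int (Suc t)) mod m)"
      by (simp add: mod_simps algebra_simps)
    with Suc show ?case by (rule rtranclp.rtrancl_into_rtrancl)
  qed
  obtain q where q: "m + 1 = 2 * q" using assms(1) by (metis evenE odd_even_add odd_one)
  define t where "t = nat (((j - i) * q) mod m)"
  have "int t = ((j - i) * q) mod m" using m by (simp add: t_def)
  then have "(i + 2 * int t) mod m = (i + 2 * ((j - i) * q)) mod m"
    by (simp only: mod_affine(2))
  also have "i + 2 * ((j - i) * q) = i + (j - i) * (2 * q)" by simp
  also have "i + (j - i) * (2 * q) = j + (j - i) * m" unfolding q[symmetric] by (simp add: algebra_simps)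
  also have "(j + (j - i) * m) mod m = j" using assms by simp
  finally show ?thesis using walk[of t] by simp
qed

end

text \<open>Translation by \<open>2 * a\<close> changes the sign; an odd number \<open>m\<close> of such translations is a translation
  by a multiple of the period. Hence the operator \<open>T^a + T^(-a)\<close>, with \<open>T\<close> the unit translation, is
  injective on functions of odd period.\<close>

lemma alternating_periodic:
  fixes y :: "int \<Rightarrow> real" and m :: int
  assumes per: "\<And>i. y (i + m) = y i" and "odd m" "m > 0"
    and alt: "\<And>i. y (i + a) + y (i - a) = 0"
  shows "y i = 0"
proof -
  have step: "y (i + 2 * a) = - y i" for i using alt[of "i + a"] by (simp add: algebra_simps)
  have "y (i + 2 * a * int t) = (-1) ^ t * y i" for t
  proof (induction t)
    case (Suc t)
    then show ?case using step[of "i + 2 * a * int t"] by (simp add: algebra_simps)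
  qed simp
  from this[of "nat m"] have "y (i + m * (2 * a)) = - y i"
    using assms by (simp add: even_nat_iff ac_simps)
  then show ?thesis using periodic_multiple[of y m i "2 * a", OF per] by simp
qed

lemma cycle_group:
  fixes m :: int assumes "m \<ge> 3" shows "circulant_group m {1, m - 1}"
proof
  have sq: "((m - 1) * (m - 1)) mod m = 1"
  proof -
    have "(m - 1) * (m - 1) = 1 + m * (m - 2)" by (simp add: algebra_simps)
    then show ?thesis using assms by simp
  qed
  show "(x * y) mod m \<in> {1, m - 1}" if "x \<in> {1, m - 1}" "y \<in> {1, m - 1}" for x y
    using that sq assms by (auto simp: zmod_minus1)
  show "\<exists>y\<in>{1, m - 1}. (x * y) mod m = 1" if "x \<in> {1, m - 1}" for x
    using that sq assms by (auto simp: zmod_minus1)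
qed (use assms in auto)

lemma cycle_arc_nonsingular:
  fixes m :: int
  assumes m3: "m \<ge> 3" "odd m"
  shows "arc_nonsingular {0..<m} (circulant m {1, m - 1}) 2"
proof -
  interpret circulant_group m "{1, m - 1}" by (rule cycle_group[OF m3(1)])
  have "arc_nonsingular {0..<m} (circulant m {1, m - 1}) (card {1, m - 1})"
  proof (rule arc_nonsingular)
    fix y :: "int \<Rightarrow> real" and i
    assume per: "\<And>i. y (i + m) = y i" and s: "\<And>i. (\<Sum>h\<in>{1, m - 1}. y (i + h)) = 0"
    have "y (i + 1) + y (i - 1) = 0" for i
      using s[of i] per[of "i - 1"] m3 by (cases "m = 2") (simp_all add: algebra_simps)
    then show "y i = 0" using alternating_periodic[of y m 1 i, OF per] m3 by simp
  qed
  moreover have "card {1, m - 1} = 2" using m3 by simp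
  ultimately show ?thesis by (simp only:)
qed

text \<open>The four connecting elements are the powers of a square root \<open>k\<close> of \<open>-1\<close>. With
  \<open>a = (k + 1) / 2\<close> and \<open>b = (k - 1) / 2\<close> the adjacency operator factors as
  \<open>(T^a + T^(-a)) (T^b + T^(-b))\<close>, which is why \<open>k\<close> is taken odd, and each factor is injective.\<close>

lemma quartic_circulant_arc_nonsingular:
  fixes m k :: int
  assumes m1: "m > 1" "odd m" and k: "odd k" "1 < k" "k < m - 1" and "k * k mod m = m - 1"
  shows "circulant_group m {1, k, m - k, m - 1}" (is "circulant_group m ?H")
    and "arc_nonsingular {0..<m} (circulant m {1, k, m - k, m - 1}) 4"
proof -
  have kk: "k * k mod m = m - 1" by fact
  have neg: "(x * (m - y)) mod m = (- (x * y mod m)) mod m" "((m - y) * x) mod m = (- (x * y mod m)) mod m"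
    "((m - x) * (m - y)) mod m = x * y mod m" for x y
  proof -
    have "x * (m - y) = - (x * y) + m * x" "(m - y) * x = - (x * y) + m * x"
      "(m - x) * (m - y) = x * y + m * (m - x - y)"
      by (simp_all add: algebra_simps)
    then show "(x * (m - y)) mod m = (- (x * y mod m)) mod m" "((m - y) * x) mod m = (- (x * y mod m)) mod m"
      "((m - x) * (m - y)) mod m = x * y mod m"
      by (simp_all only: mod_minus_eq mod_mult_self2)
  qed
  have neg1: "(- (m - 1)) mod m = 1" "(- 1) mod m = m - 1" "(-k) mod m = m - k"
    using m1 k by (simp_all add: zmod_zminus1_eq_if)
  have one_k: "1 * 1 mod m = 1" "1 * k mod m = k" "k * 1 mod m = k"
    "1 * (m - k) mod m = m - k" "1 * (m - 1) mod m = m - 1" "(m - k) * 1 mod m = m - k" "(m - 1) * 1 mod m = m - 1"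
    using m1 k by (simp_all add: neg1)
  note table = one_k kk neg(1)[of k k, unfolded kk neg1] neg(2)[of k k, unfolded kk neg1]
    neg(3)[of k k, unfolded kk] neg(1)[of k 1, unfolded one_k neg1]
    neg(2)[of 1 k, unfolded one_k neg1] neg(3)[of k 1, unfolded one_k]
    neg(3)[of 1 k, unfolded one_k] neg(3)[of 1 1, unfolded one_k]
  show grp: "circulant_group m ?H"
  proof
    show "(x * y) mod m \<in> ?H" if "x \<in> ?H" "y \<in> ?H" for x y
      using that by (elim insertE emptyE) (simp_all only: table insert_iff simp_thms)
    show "\<exists>y\<in>?H. (x * y) mod m = 1" if "x \<in> ?H" for x
      using that by (elim insertE emptyE) (simp_all only: table bex_simps simp_thms)
  qed (use m1 k in auto)
  interpret circulant_group m ?H by (rule grp)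
  have mk: "m \<noteq> 2 * k" "m - k \<noteq> k" using m1 by presburger+
  have "card ?H = 4" using k mk by auto
  moreover have "arc_nonsingular {0..<m} (circulant m ?H) (card ?H)"
  proof (rule arc_nonsingular)
    fix y :: "int \<Rightarrow> real" and i
    assume per: "\<And>i. y (i + m) = y i" and s: "\<And>i. (\<Sum>h\<in>?H. y (i + h)) = 0"
    obtain p where p: "k = 2 * p + 1" using k(1) by (elim oddE)
    define a b where "a = p + 1" and "b = p"
    define u where "u i = y (i + a) + y (i - a)" for i
    have s': "y (i + 1) + y (i + k) + y (i - k) + y (i - 1) = 0" for i
      using s[of i] per[of "i - 1"] per[of "i - k"] k mk by (simp add: algebra_simps)
    have "u (i + b) + u (i - b) = 0" for i
      using s'[of i] by (simp add: u_def a_def b_def p algebra_simps)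
    moreover have "u (i + m) = u i" for i
      using per[of "i + a"] per[of "i - a"] by (simp add: u_def algebra_simps)
    ultimately have "u i = 0" for i using alternating_periodic[of u m b i] m1 by simp
    then show "y i = 0" using alternating_periodic[of y m a i, OF per] m1 by (simp add: u_def)
  qed
  ultimately show "arc_nonsingular {0..<m} (circulant m ?H) 4" by simp
qed

text \<open>The connecting elements are the nonzero cubes modulo 19. On vectors of sum zero the matrix satisfies
  \<open>x^3 + x^2 - 6 x - 7 = 0\<close>, the equation of the cubic Gaussian periods, so it is invertible;
  the inverse gives the coefficients below.\<close>

lemma cubic_residues_19:
  "arc_nonsingular {0..<19} (circulant 19 {1, 7, 8, 11, 12, 18}) 6"
proof -
  interpret circulant_group 19 "{1, 7, 8, 11, 12, 18}"
  proof
    show "(x * y) mod 19 \<in> {1, 7, 8, 11, 12, 18}"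
      if "x \<in> {1, 7, 8, 11, 12, 18}" "y \<in> {1, 7, 8, 11, 12, 18}" for x y :: int
      using that by auto
    show "\<exists>y\<in>{1, 7, 8, 11, 12, 18}. (x * y) mod 19 = 1"
      if "x \<in> {1, 7, 8, 11, 12, 18}" for x :: int
      using that by auto
  qed auto
  have "arc_nonsingular {0..<19} (circulant 19 {1, 7, 8, 11, 12, 18}) (card {1, 7, 8, 11, 12, 18::int})"
  proof (rule arc_nonsingular)
    fix y :: "int \<Rightarrow> real" and i
    assume per: "\<And>i. y (i + 19) = y i" and s: "\<And>i. (\<Sum>h\<in>{1, 7, 8, 11, 12, 18}. y (i + h)) = 0"
    define e where "e j = y (i + j + 1) + y (i + j + 7) + y (i + j + 8) + y (i + j + 11)
      + y (i + j + 12) + y (i + j + 18)" for j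
    have e0: "e j = 0" for j using s[of "i + j"] by (simp add: e_def add.assoc)
    have red: "y (i + (19 + j)) = y (i + j)" for j using per[of "i + j"] by (simp add: algebra_simps)
    \<comment> \<open>42 times the inverse circulant; its entries are constant on cosets of the cubes.\<close>
    have "42 * y i = - 11 * e 0
        + 7 * (e 1 + e 7 + e 8 + e 11 + e 12 + e 18)
        - 5 * (e 2 + e 3 + e 5 + e 14 + e 16 + e 17)
        + (e 4 + e 6 + e 9 + e 10 + e 13 + e 15)"
      using red[of 0] red[of 1] red[of 2] red[of 3] red[of 4] red[of 5] red[of 6] red[of 7] red[of 8]
        red[of 9] red[of 10] red[of 11] red[of 12] red[of 13] red[of 14] red[of 15] red[of 16] red[of 17]
      unfolding e_def by (simp add: add.assoc)
    then show "y i = 0" by (simp add: e0)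
  qed
  moreover have "card {1, 7, 8, 11, 12, 18::int} = 6" by simp
  ultimately show ?thesis by (simp only:)
qed

section \<open>Kneser graphs and rook's graphs\<close>

text \<open>The Kneser graph on the pairs from a \<open>v\<close>-element set. For a kernel vector \<open>x\<close> let \<open>d u\<close> be the
  sum over the pairs through \<open>u\<close> and \<open>X\<close> the total sum. By inclusion and exclusion
  \<open>x {u, w} = d u + d w - X\<close>; summing over \<open>w\<close> shows that \<open>d\<close> is constant, and double counting
  makes the constant zero.\<close>

lemma kneser_arc_nonsingular:
  assumes v: "v \<ge> 5"
  defines "P \<equiv> {e. e \<subseteq> {0..<v} \<and> card e = 2}"
  shows "arc_nonsingular P (\<lambda>e f. e \<inter> f = {}) ((v - 2) choose 2)" and "card P = v choose 2"
proof -
  let ?S = "\<lambda>e f :: nat set. e \<inter> f = {}"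
  let ?U = "{0..<v}"
  show cP: "card P = v choose 2" using n_subsets[of ?U 2] by (simp add: P_def)
  have finP: "finite P" unfolding P_def by (rule finite_subset[of _ "Pow ?U"]) auto
  have pair: "{u, w} \<in> P" if "u < v" "w < v" "u \<noteq> w" for u w using that by (simp add: P_def)
  have pairE: "\<exists>u w. e = {u, w} \<and> u < v \<and> w < v \<and> u \<noteq> w" if e: "e \<in> P" for e
  proof -
    obtain u w where uw: "e = {u, w}" "u \<noteq> w" using e by (auto simp: P_def card_2_iff)
    then have "u < v" "w < v" using e by (auto simp: P_def)
    then show ?thesis using uw by blast
  qed
  have fin_e: "finite e" if "e \<in> P" for e using that by (intro card_ge_0_finite) (simp add: P_def)
  show "arc_nonsingular P ?S ((v - 2) choose 2)"
  proof
    show "finite P" by (rule finP)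
    show "P \<noteq> {}" using pair[of 0 1] v by auto
    show "0 < (v - 2) choose 2" using v by (simp add: zero_less_binomial_iff)
    show "f \<inter> e = {}" if "e \<inter> f = {}" for e f :: "nat set" using that by auto
    show "card (nbrs P ?S e) = (v - 2) choose 2" if e: "e \<in> P" for e
    proof -
      have "nbrs P ?S e = {f. f \<subseteq> ?U - e \<and> card f = 2}" by (auto simp: nbrs_def P_def)
      moreover have "card (?U - e) = v - 2" using e by (simp add: P_def card_Diff_subset fin_e[OF e])
      ultimately show ?thesis using n_subsets[of "?U - e" 2] by simp
    qed
    show "x e0 = 0" if x: "\<And>e. e \<in> P \<Longrightarrow> (\<Sum>f\<in>nbrs P ?S e. x f) = (0::real)" and e0: "e0 \<in> P" for x e0
    proof -
      define d where "d u = (\<Sum>f\<in>{f \<in> P. u \<in> f}. x f)" for u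
      define X where "X = (\<Sum>f\<in>P. x f)"
      have d_alt: "d u = (\<Sum>f\<in>P. if u \<in> f then x f else 0)" for u
        unfolding d_def by (simp only: sum.inter_filter finP)
      have rel: "x {u, w} = d u + d w - X" if uw: "u < v" "w < v" "u \<noteq> w" for u w
      proof -
        have "X = (\<Sum>f\<in>P. (if {u, w} \<inter> f = {} then x f else 0) + (if u \<in> f then x f else 0)
            + (if w \<in> f then x f else 0) - (if f = {u, w} then x f else 0))"
          unfolding X_def
        proof (rule sum.cong[OF refl])
          fix f assume "f \<in> P"
          then obtain a b where f: "f = {a, b}" "a \<noteq> b" using pairE by blast
          have "f = {u, w} \<longleftrightarrow> u \<in> f \<and> w \<in> f" using f uw by auto
          then show "x f = (if {u, w} \<inter> f = {} then x f else 0) + (if u \<in> f then x f else 0)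
            + (if w \<in> f then x f else 0) - (if f = {u, w} then x f else 0)" by auto
        qed
        also have "\<dots> = (\<Sum>f\<in>P. if {u, w} \<inter> f = {} then x f else 0) + d u + d w - x {u, w}"
          using finP pair[OF uw] by (simp only: sum_subtractf sum.distrib d_alt sum.delta if_True)
        also have "(\<Sum>f\<in>P. if {u, w} \<inter> f = {} then x f else 0) = (\<Sum>f\<in>nbrs P ?S {u, w}. x f)"
          by (simp only: nbrs_def sum.inter_filter finP)
        finally show ?thesis using x[OF pair[OF uw]] by simp
      qed
      define D where "D = (\<Sum>u\<in>?U. d u)"
      have "D = (\<Sum>f\<in>P. \<Sum>u\<in>?U. if u \<in> f then x f else 0)"
        unfolding D_def d_alt by (rule sum.swap)
      also have "\<dots> = (\<Sum>f\<in>P. 2 * x f)"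
      proof (rule sum.cong[OF refl])
        fix f assume f: "f \<in> P"
        have "(\<Sum>u\<in>?U. if u \<in> f then x f else 0) = (\<Sum>u\<in>{u \<in> ?U. u \<in> f}. x f)"
          by (simp only: sum.inter_filter finite_atLeastLessThan)
        also have "{u \<in> ?U. u \<in> f} = f" using f by (auto simp: P_def)
        finally show "(\<Sum>u\<in>?U. if u \<in> f then x f else 0) = 2 * x f" using f by (simp add: P_def)
      qed
      finally have D: "D = 2 * X" by (simp add: X_def sum_distrib_left)
      have du: "(real v - 3) * d u = (real v - 1) * X - D" if u: "u < v" for u
      proof -
        have bij: "bij_betw (\<lambda>w. {u, w}) (?U - {u}) {f \<in> P. u \<in> f}"
          unfolding bij_betw_def
        proof
          show "inj_on (\<lambda>w. {u, w}) (?U - {u})" by (auto simp: inj_on_def doubleton_eq_iff)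
          show "(\<lambda>w. {u, w}) ` (?U - {u}) = {f \<in> P. u \<in> f}"
          proof (intro equalityI subsetI)
            fix f assume "f \<in> {f \<in> P. u \<in> f}"
            then obtain a b where "f = {a, b}" "a < v" "b < v" "a \<noteq> b" "u = a \<or> u = b"
              using pairE by blast
            then show "f \<in> (\<lambda>w. {u, w}) ` (?U - {u})" by (auto simp: insert_commute)
          qed (use u pair in auto)
        qed
        have "d u = (\<Sum>w\<in>?U - {u}. x {u, w})"
          unfolding d_def by (rule sum.reindex_bij_betw[OF bij, symmetric])
        also have "\<dots> = (\<Sum>w\<in>?U - {u}. d u + d w - X)"
          using rel u by (intro sum.cong refl) auto
        also have "\<dots> = (real v - 1) * (d u - X) + (\<Sum>w\<in>?U - {u}. d w)"
          using u v by (simp add: sum.distrib sum_subtractf of_nat_diff algebra_simps)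
        also have "(\<Sum>w\<in>?U - {u}. d w) = D - d u"
          using u by (simp add: D_def sum_diff1)
        finally show ?thesis by (simp add: algebra_simps)
      qed
      have v3: "real v - 3 \<noteq> 0" using v by auto
      define \<delta> where "\<delta> = ((real v - 1) * X - D) / (real v - 3)"
      have d\<delta>: "d u = \<delta>" if "u < v" for u using du[OF that] v3 by (simp add: \<delta>_def field_simps)
      then have "D = real v * \<delta>" by (simp add: D_def)
      then have X: "X = real v * \<delta> / 2" using D by simp
      have "(real v - 3) * \<delta> = (real v - 1) * X - 2 * X" using du[of 0] d\<delta>[of 0] v D by simp
      then have "(real v - 3) * (\<delta> * (real v - 2)) = 0" unfolding X by (simp add: field_simps)
      then have "\<delta> = 0" using v by auto
      then have "x {u, w} = 0" if "u < v" "w < v" "u \<noteq> w" for u w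
        using rel[OF that] d\<delta> that X by simp
      then show ?thesis using pairE[OF e0] by auto
    qed
    show "\<exists>g\<in>automorphisms P ?S. g e = e' \<and> g f = f'"
      if ef: "e \<in> P" "f \<in> P" "e \<inter> f = {}" and ef': "e' \<in> P" "f' \<in> P" "e' \<inter> f' = {}" for e f e' f'
    proof -
      obtain a b c d where abcd: "e = {a, b}" "f = {c, d}" "a \<noteq> b" "c \<noteq> d" "{a, b, c, d} \<subseteq> ?U"
        using pairE[OF ef(1)] pairE[OF ef(2)] by auto
      obtain a' b' c' d' where abcd': "e' = {a', b'}" "f' = {c', d'}" "a' \<noteq> b'" "c' \<noteq> d'"
          "{a', b', c', d'} \<subseteq> ?U"
        using pairE[OF ef'(1)] pairE[OF ef'(2)] by auto
      let ?f = "\<lambda>i. if i = a then a' else if i = b then b' else if i = c then c' else d'"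
      have "\<exists>g. bij_betw g ?U ?U \<and> (\<forall>i\<in>{a, b, c, d}. g i = ?f i)"
        by (rule extend_bijection) (use abcd abcd' ef(3) ef'(3) in \<open>auto simp: inj_on_def\<close>)
      then obtain g where g: "bij_betw g ?U ?U" "\<forall>i\<in>{a, b, c, d}. g i = ?f i" by blast
      have img: "g ` e = e'" "g ` f = f'" using g(2) abcd abcd' ef(3) by auto
      have inj: "inj_on g ?U" and surj: "g ` ?U = ?U" using g(1) by (auto simp: bij_betw_def)
      have sub: "s \<subseteq> ?U" if "s \<in> P" for s using that by (auto simp: P_def)
      have inter: "g ` s \<inter> g ` t = g ` (s \<inter> t)" if "s \<in> P" "t \<in> P" for s t
        using inj_on_image_Int[OF inj sub[OF that(1)] sub[OF that(2)]] by simp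
      have into: "(`) g ` P \<subseteq> P"
      proof
        fix t assume "t \<in> (`) g ` P"
        then obtain s where s: "s \<in> P" "t = g ` s" by auto
        have "card t = 2" using card_image[OF inj_on_subset[OF inj sub[OF s(1)]]] s by (simp add: P_def)
        moreover have "t \<subseteq> ?U" using s sub[OF s(1)] surj by blast
        ultimately show "t \<in> P" by (simp add: P_def)
      qed
      have injP: "inj_on ((`) g) P"
        using inj_on_image_eq_iff[OF inj] sub by (auto simp: inj_on_def)
      have "bij_betw ((`) g) P P"
        unfolding bij_betw_def using injP endo_inj_surj[OF finP into injP] by blast
      then have "(`) g \<in> automorphisms P ?S" by (simp add: automorphisms_def inter)
      then show ?thesis using img by blast
    qed
  qed
qed

text \<open>A kernel vector satisfies \<open>2 x (i, j) = r i + c j\<close> with row sums \<open>r\<close> and column sums \<open>c\<close>; summing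
  over rows and columns forces these to vanish.\<close>

lemma rook_arc_nonsingular:
  assumes n: "n \<ge> 3"
  defines "V \<equiv> {0..<n} \<times> {0..<n}"
  shows "arc_nonsingular V (\<lambda>p q. p \<noteq> q \<and> (fst p = fst q \<or> snd p = snd q)) (2 * (n - 1))"
proof -
  let ?S = "\<lambda>p q :: nat \<times> nat. p \<noteq> q \<and> (fst p = fst q \<or> snd p = snd q)"
  let ?U = "{0..<n}"
  have nb: "nbrs V ?S (i, j) = {i} \<times> (?U - {j}) \<union> (?U - {i}) \<times> {j}" if "i < n" "j < n" for i j
    using that by (auto simp: nbrs_def V_def)
  show ?thesis
  proof
    show "finite V" by (simp add: V_def)
    show "V \<noteq> {}" "0 < 2 * (n - 1)" using n by (auto simp: V_def)
    show "?S q p" if "?S p q" for p q using that by auto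
    show "card (nbrs V ?S p) = 2 * (n - 1)" if "p \<in> V" for p
    proof -
      obtain i j where p: "p = (i, j)" "i < n" "j < n" using \<open>p \<in> V\<close> by (auto simp: V_def)
      show ?thesis unfolding p(1) nb[OF p(2,3)]
        by (subst card_Un_disjoint) (use p in \<open>auto simp: card_cartesian_product\<close>)
    qed
    show "x p = 0" if x: "\<And>p. p \<in> V \<Longrightarrow> (\<Sum>q\<in>nbrs V ?S p. x q) = (0::real)" and p: "p \<in> V" for x p
    proof -
      define r where "r i = (\<Sum>j\<in>?U. x (i, j))" for i
      define c where "c j = (\<Sum>i\<in>?U. x (i, j))" for j
      define X where "X = (\<Sum>i\<in>?U. r i)"
      have X_c: "X = (\<Sum>j\<in>?U. c j)" unfolding X_def r_def c_def by (rule sum.swap)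
      have rel: "2 * x (i, j) = r i + c j" if ij: "i < n" "j < n" for i j
      proof -
        have "(\<Sum>q\<in>nbrs V ?S (i, j). x q) = (\<Sum>q\<in>{i} \<times> (?U - {j}). x q) + (\<Sum>q\<in>(?U - {i}) \<times> {j}. x q)"
          unfolding nb[OF ij] by (rule sum.union_disjoint) auto
        also have "(\<Sum>q\<in>{i} \<times> (?U - {j}). x q) = (\<Sum>k\<in>?U - {j}. x (i, k))"
          by (simp add: sum.cartesian_product[symmetric, of "\<lambda>a b. x (a, b)", simplified])
        also have "\<dots> = r i - x (i, j)" using ij by (simp add: r_def sum_diff1)
        also have "(\<Sum>q\<in>(?U - {i}) \<times> {j}. x q) = (\<Sum>k\<in>?U - {i}. x (k, j))"
          by (simp add: sum.cartesian_product[symmetric, of "\<lambda>a b. x (a, b)", simplified])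
        also have "\<dots> = c j - x (i, j)" using ij by (simp add: c_def sum_diff1)
        finally show ?thesis using x[of "(i, j)"] ij by (simp add: V_def)
      qed
      have r: "(real n - 2) * r i = - X" if "i < n" for i
      proof -
        have "2 * r i = (\<Sum>j\<in>?U. r i + c j)"
          unfolding r_def[of i] sum_distrib_left using rel[OF that] by (intro sum.cong) (auto simp: r_def)
        then show ?thesis by (simp add: sum.distrib X_c algebra_simps)
      qed
      have c: "(real n - 2) * c j = - X" if "j < n" for j
      proof -
        have "2 * c j = (\<Sum>i\<in>?U. r i + c j)"
          unfolding c_def[of j] sum_distrib_left using rel[OF _ that] by (intro sum.cong) (auto simp: c_def)
        then show ?thesis by (simp add: sum.distrib X_def algebra_simps)
      qed
      have "(real n - 2) * X = (\<Sum>i\<in>?U. - X)"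
        unfolding X_def sum_distrib_left using r by (intro sum.cong) (auto simp: X_def)
      then have "(2 * real n - 2) * X = 0" by (simp add: algebra_simps)
      then have "X = 0" using n by auto
      then have "r i = 0" "c i = 0" if "i < n" for i using r[OF that] c[OF that] n by auto
      then show ?thesis using rel p by (auto simp: V_def)
    qed
    show "\<exists>g\<in>automorphisms V ?S. g p = p' \<and> g q = q'"
      if pq: "p \<in> V" "q \<in> V" "?S p q" and pq': "p' \<in> V" "q' \<in> V" "?S p' q'" for p q p' q'
    proof -
      have lines: "\<exists>g\<in>automorphisms V ?S. g (i, j) = (i', j') \<and> g (i, k) = (i', k')"
        if ij: "i < n" "j < n" "k < n" "j \<noteq> k" "i' < n" "j' < n" "k' < n" "j' \<noteq> k'" for i j k i' j' k'
      proof -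
        have "\<exists>g. bij_betw g ?U ?U \<and> (\<forall>a\<in>{i}. g a = i')"
          by (rule extend_bijection) (use ij in auto)
        then obtain g where g: "bij_betw g ?U ?U" "g i = i'" by auto
        have "\<exists>h. bij_betw h ?U ?U \<and> (\<forall>a\<in>{j, k}. h a = (if a = j then j' else k'))"
          by (rule extend_bijection) (use ij in \<open>auto simp: inj_on_def\<close>)
        then obtain h where "bij_betw h ?U ?U" "\<forall>a\<in>{j, k}. h a = (if a = j then j' else k')" by blast
        then have h: "bij_betw h ?U ?U" "h j = j'" "h k = k'" using ij(4) by auto
        have "map_prod g h \<in> automorphisms V ?S"
          using g(1) h(1) by (auto simp: automorphisms_def V_def intro!: bij_betw_map_prod)
            (auto simp: bij_betw_def inj_on_eq_iff)
        then show ?thesis using g h by (intro bexI[of _ "map_prod g h"]) auto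
      qed
      have swap: "prod.swap \<in> automorphisms V ?S"
        by (auto simp: automorphisms_def V_def bij_betw_def)
      \<comment> \<open>Every arc is, up to transposition of the board, an arc along a row.\<close>
      have row: "\<exists>t\<in>{id, prod.swap}. \<exists>i j k. p = t (i, j) \<and> q = t (i, k) \<and> i < n \<and> j < n \<and> k < n \<and> j \<noteq> k"
        if "p \<in> V" "q \<in> V" "?S p q" for p q
      proof (cases "fst p = fst q")
        case True
        show ?thesis
          by (rule bexI[of _ id], rule exI[of _ "fst p"], rule exI[of _ "snd p"], rule exI[of _ "snd q"])
            (use True that in \<open>auto simp: V_def prod_eq_iff\<close>)
      next
        case False
        show ?thesis
          by (rule bexI[of _ prod.swap], rule exI[of _ "snd p"], rule exI[of _ "fst p"], rule exI[of _ "fst q"])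
            (use False that in \<open>auto simp: V_def prod_eq_iff\<close>)
      qed
      obtain t i j k where t: "t \<in> {id, prod.swap}" "p = t (i, j)" "q = t (i, k)"
        and ijk: "i < n" "j < n" "k < n" "j \<noteq> k" using row[OF pq] by blast
      obtain t' i' j' k' where t': "t' \<in> {id, prod.swap}" "p' = t' (i', j')" "q' = t' (i', k')"
        and ijk': "i' < n" "j' < n" "k' < n" "j' \<noteq> k'" using row[OF pq'] by blast
      obtain g where g: "g \<in> automorphisms V ?S" "g (i, j) = (i', j')" "g (i, k) = (i', k')"
        using lines[OF ijk ijk'] by blast
      have "t \<in> automorphisms V ?S" "t' \<in> automorphisms V ?S"
        using t(1) t'(1) swap by (auto simp: automorphisms_def)
      then have "t' \<circ> (g \<circ> t) \<in> automorphisms V ?S" using automorphisms_comp g(1) by blast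
      moreover have "t (t p) = p" for p using t(1) by auto
      ultimately show ?thesis using g t t' by (intro bexI[of _ "t' \<circ> (g \<circ> t)"]) auto
    qed
  qed
qed

section \<open>Nut graphs with two vertex orbits and three edge orbits\<close>

lemma one_dimensional_kernel:
  fixes A :: "real mat"
  assumes A: "A \<in> carrier_mat n n" and x: "x \<in> mat_kernel A" and x0: "x \<noteq> 0\<^sub>v n"
    and mult: "\<And>y. y \<in> mat_kernel A \<Longrightarrow> \<exists>c. y = c \<cdot>\<^sub>v x"
  shows "kernel_dim A = 1"
    and "mat_kernel A = LinearCombinations.module.span class_ring (module_vec TYPE(real) n) {x}"
proof -
  interpret kernel n n A by unfold_locales (rule A)
  have car: "x \<in> carrier_vec n" using x A by (auto simp: mat_kernel_def)
  have nspan: "NC.span {x} = mat_kernel A"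
  proof
    show "NC.span {x} \<subseteq> mat_kernel A"
      using span_same[of "{x}"] Ker.span_is_subset2[of "{x}"] x by auto
    show "mat_kernel A \<subseteq> NC.span {x}"
    proof
      fix y assume "y \<in> mat_kernel A"
      then obtain c where "y = c \<cdot>\<^sub>v x" using mult by blast
      moreover have "x \<in> NC.span {x}" using car NC.in_own_span[of "{x}"] by auto
      ultimately show "y \<in> NC.span {x}" using car NC.smult_in_span[of "{x}"] by auto
    qed
  qed
  then show "mat_kernel A = LinearCombinations.module.span class_ring (module_vec TYPE(real) n) {x}"
    by simp
  have "dim = 1"
  proof (rule Ker.dim1I)
    show "x \<in> mat_kernel A" by (rule x)
    show "\<not> x = 0\<^sub>v n" by (rule x0)
    show "span {x} = mat_kernel A" using nspan span_same[of "{x}"] x by auto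
  qed
  then show "kernel_dim A = 1" by simp
qed

lemma orbits_eqI:
  assumes "\<Union> P = X" and "{} \<notin> P"
    and "\<And>A x g. \<lbrakk>A \<in> P; x \<in> A; g \<in> carrier G\<rbrakk> \<Longrightarrow> \<phi> g x \<in> A"
    and "\<And>A x y. \<lbrakk>A \<in> P; x \<in> A; y \<in> A\<rbrakk> \<Longrightarrow> \<exists>g\<in>carrier G. \<phi> g x = y"
  shows "orbits G X \<phi> = P"
proof -
  have orb: "orbit G \<phi> x = A" if "A \<in> P" "x \<in> A" for A x
  proof
    show "orbit G \<phi> x \<subseteq> A" using assms(3)[OF that] by (auto simp: orbit_def)
    show "A \<subseteq> orbit G \<phi> x" using assms(4)[OF that] by (auto simp: orbit_def)
  qed
  show ?thesis
  proof
    show "orbits G X \<phi> \<subseteq> P" using assms(1) orb by (auto simp: orbits_def)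
    show "P \<subseteq> orbits G X \<phi>"
    proof
      fix A assume A: "A \<in> P"
      then obtain x where x: "x \<in> A" using assms(2) by (cases "A = {}") auto
      then have "x \<in> X" using A assms(1) by auto
      then show "A \<in> orbits G X \<phi>" using orb[OF A x] by (auto simp: orbits_def)
    qed
  qed
qed

text \<open>A graph whose two prospective vertex orbits are told apart by their degrees, so that no automorphism
  can mix them, and whose arcs of each of the three possible kinds are permuted transitively.
  The vector \<open>z\<close> spans the kernel.\<close>

locale two_orbit_nut =
  fixes V V1 V2 :: "'a set" and adj :: "'a \<Rightarrow> 'a \<Rightarrow> bool" and k1 k2 :: nat and z :: "'a \<Rightarrow> real"
  assumes V_def: "V = V1 \<union> V2" and fin: "finite V1" "finite V2" and disjoint: "V1 \<inter> V2 = {}"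
    and irrefl: "v \<in> V \<Longrightarrow> \<not> adj v v"
    and sym: "\<lbrakk>u \<in> V; v \<in> V; adj u v\<rbrakk> \<Longrightarrow> adj v u"
    and deg1: "v \<in> V1 \<Longrightarrow> card (nbrs V adj v) = k1"
    and deg2: "v \<in> V2 \<Longrightarrow> card (nbrs V adj v) = k2"
    and degs: "k1 \<noteq> k2"
    and z_nonzero: "v \<in> V \<Longrightarrow> z v \<noteq> 0"
    and z_kernel: "v \<in> V \<Longrightarrow> (\<Sum>w\<in>nbrs V adj v. z w) = 0"
    and kernel_z: "(\<And>v. v \<in> V \<Longrightarrow> (\<Sum>w\<in>nbrs V adj v. y w) = 0) \<Longrightarrow> \<exists>c. \<forall>v\<in>V. y v = c * z v"
    and edge11: "\<exists>u\<in>V1. \<exists>w\<in>V1. adj u w" and edge22: "\<exists>u\<in>V2. \<exists>w\<in>V2. adj u w"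
    and edge12: "u \<in> V1 \<Longrightarrow> \<exists>w\<in>V2. adj u w" and edge21: "w \<in> V2 \<Longrightarrow> \<exists>u\<in>V1. adj u w"
    and arc: "\<lbrakk>(P, Q) \<in> {(V1, V1), (V1, V2), (V2, V2)}; u \<in> P; w \<in> Q; adj u w;
        u' \<in> P; w' \<in> Q; adj u' w'\<rbrakk> \<Longrightarrow> \<exists>g\<in>automorphisms V adj. g u = u' \<and> g w = w'"
begin

lemma vertex_transitive:
  assumes "P \<in> {V1, V2}" "u \<in> P" "u' \<in> P" shows "\<exists>g\<in>automorphisms V adj. g u = u'"
proof (cases "P = V1")
  case True
  then obtain w w' where "w \<in> V2" "adj u w" "w' \<in> V2" "adj u' w'" using edge12 assms by metis
  then show ?thesis using arc[of V1 V2 u w u' w'] True assms by auto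
next
  case False
  then have "u \<in> V2" "u' \<in> V2" using assms by auto
  moreover obtain w w' where "w \<in> V1" "adj w u" "w' \<in> V1" "adj w' u'"
    using edge21 calculation by metis
  ultimately show ?thesis using arc[of V1 V2 w u w' u'] by auto
qed

text \<open>An automorphism preserves degrees, hence \<open>V1\<close> and \<open>V2\<close>, hence the three kinds of edges; so
  there are at least as many orbits as claimed, and transitivity shows that there are no more. In the
  proof a bijection \<open>f\<close> from \<open>{0..<n}\<close>, with inverse \<open>h\<close>, numbers the abstract vertices.\<close>

lemma realise:
  "\<exists>E. nut_graph (card V) E \<and> card (vertex_orbits (card V) E) = 2 \<and> card (edge_orbits (card V) E) = 3"
proof -
  define n where "n = card V"
  have finV: "finite V" using fin by (simp add: V_def)
  obtain f where f: "bij_betw f {0..<n} V"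
    using ex_bij_betw_nat_finite[OF finV] by (auto simp: n_def)
  define h where "h = inv_into {0..<n} f"
  have h: "bij_betw h V {0..<n}" unfolding h_def by (rule bij_betw_inv_into[OF f])
  have fV: "f i \<in> V" if "i < n" for i using f that by (auto simp: bij_betw_def)
  have hn: "h v < n" if "v \<in> V" for v using h that by (auto simp: bij_betw_def)
  have fh: "f (h v) = v" if "v \<in> V" for v
    unfolding h_def using f that by (simp add: bij_betw_inv_into_right)
  have hf: "h (f i) = i" if "i < n" for i
    unfolding h_def using f that by (simp add: bij_betw_inv_into_left)
  have hinj: "h u = h v \<longleftrightarrow> u = v" if "u \<in> V" "v \<in> V" for u v using fh that by metis
  have V12: "v \<in> V" if "v \<in> V1 \<or> v \<in> V2" for v using that by (auto simp: V_def)
  define E where "E = {{i, j} | i j. i < n \<and> j < n \<and> adj (f i) (f j)}"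
  have edge: "{i, j} \<in> E \<longleftrightarrow> adj (f i) (f j)" if "i < n" "j < n" for i j
    using that sym fV by (auto simp: E_def doubleton_eq_iff)
  have edge_h: "{h u, h w} \<in> E \<longleftrightarrow> adj u w" if "u \<in> V" "w \<in> V" for u w
    using that by (simp add: edge hn fh)
  have simple: "simple_graph n E"
    using irrefl fV by (auto simp: simple_graph_def E_def card_2_iff) metis
  have nb: "bij_betw h (nbrs V adj (f i)) {j. j < n \<and> {i, j} \<in> E}" if "i < n" for i
    by (rule bij_betwI[where g = f]) (auto simp: nbrs_def that edge fV hn hf fh)

  define A where "A = adjacency_matrix n E"
  have A: "A \<in> carrier_mat n n" by (simp add: A_def adjacency_matrix_def)
  have mult: "(A *\<^sub>v y) $ i = (\<Sum>w\<in>nbrs V adj (f i). y $ (h w))"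
    if "y \<in> carrier_vec n" "i < n" for y i
  proof -
    have "(A *\<^sub>v y) $ i = (\<Sum>j\<in>{0..<n}. if {i, j} \<in> E then y $ j else 0)"
      using that by (auto simp: A_def adjacency_matrix_def scalar_prod_def intro!: sum.cong)
    also have "\<dots> = (\<Sum>j\<in>{j\<in>{0..<n}. {i, j} \<in> E}. y $ j)"
      by (simp only: sum.inter_filter finite_atLeastLessThan)
    also have "{j\<in>{0..<n}. {i, j} \<in> E} = {j. j < n \<and> {i, j} \<in> E}" by auto
    also have "(\<Sum>j\<in>\<dots>. y $ j) = (\<Sum>w\<in>nbrs V adj (f i). y $ (h w))"
      by (rule sum.reindex_bij_betw[OF nb[OF that(2)], symmetric])
    finally show ?thesis .
  qed
  define x where "x = vec n (z \<circ> f)"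
  have x: "x \<in> carrier_vec n" by (simp add: x_def)
  have "A *\<^sub>v x = 0\<^sub>v n"
  proof (rule eq_vecI)
    fix i assume "i < dim_vec (0\<^sub>v n)"
    then have i: "i < n" by simp
    have "(\<Sum>w\<in>nbrs V adj (f i). x $ (h w)) = (\<Sum>w\<in>nbrs V adj (f i). z w)"
      by (rule sum.cong) (auto simp: nbrs_def x_def hn fh)
    then show "(A *\<^sub>v x) $ i = 0\<^sub>v n $ i" using mult[OF x i] z_kernel[OF fV[OF i]] i by simp
  qed (use A in simp)
  then have x_ker: "x \<in> mat_kernel A" by (rule mat_kernelI[OF A x])
  have "V \<noteq> {}" using edge11 by (auto simp: V_def)
  then obtain v where v: "v \<in> V" by auto
  have x0: "x \<noteq> 0\<^sub>v n"
  proof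
    assume "x = 0\<^sub>v n"
    then have "x $ (h v) = 0" using hn[OF v] by simp
    then show False using z_nonzero[OF v] hn[OF v] fh[OF v] by (simp add: x_def)
  qed
  have mult_x: "\<exists>c. y = c \<cdot>\<^sub>v x" if "y \<in> mat_kernel A" for y
  proof -
    have y: "y \<in> carrier_vec n" "A *\<^sub>v y = 0\<^sub>v n" using mat_kernelD[OF A that] by auto
    have "(\<Sum>w\<in>nbrs V adj v. y $ (h w)) = 0" if "v \<in> V" for v
      using mult[OF y(1) hn[OF that]] y(2) hn[OF that] fh[OF that] by simp
    then obtain c where c: "\<forall>v\<in>V. y $ (h v) = c * z v" using kernel_z[of "\<lambda>v. y $ (h v)"] by auto
    have "y = c \<cdot>\<^sub>v x"
    proof (rule eq_vecI)
      show "dim_vec y = dim_vec (c \<cdot>\<^sub>v x)" using x y by simp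
      fix i assume "i < dim_vec (c \<cdot>\<^sub>v x)"
      then have "i < n" using x by simp
      then show "y $ i = (c \<cdot>\<^sub>v x) $ i"
        using bspec[OF c fV[of i]] x by (simp add: hf x_def)
    qed
    then show ?thesis ..
  qed
  have nut: "nut_graph n E"
    unfolding nut_graph_def A_def[symmetric]
    using simple one_dimensional_kernel[OF A x_ker x0 mult_x] x_ker z_nonzero fV
    by (auto intro!: bexI[of _ x] simp: x_def)

  have aut_in: "\<exists>p\<in>carrier (Aut n E). \<forall>v\<in>V. p (h v) = h (g v)" if g: "g \<in> automorphisms V adj" for g
  proof -
    have gV: "bij_betw g V V" and gadj: "\<And>u w. \<lbrakk>u \<in> V; w \<in> V\<rbrakk> \<Longrightarrow> adj (g u) (g w) \<longleftrightarrow> adj u w"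
      using g by (auto simp: automorphisms_def)
    have gv: "g v \<in> V" if "v \<in> V" for v using gV that by (auto simp: bij_betw_def)
    define p where "p = (\<lambda>i. if i < n then h (g (f i)) else i)"
    have "bij_betw (h \<circ> (g \<circ> f)) {0..<n} {0..<n}"
      by (rule bij_betw_trans[OF bij_betw_trans[OF f gV] h])
    then have "bij_betw p {0..<n} {0..<n}"
      by (rule bij_betw_cong[THEN iffD1, rotated]) (simp add: p_def)
    then have "p permutes {0..<n}" by (rule bij_imp_permutes) (simp add: p_def)
    moreover have "{p u, p w} \<in> E \<longleftrightarrow> {u, w} \<in> E" if "u < n" "w < n" for u w
      using that by (simp add: p_def edge_h gv fV gadj edge)
    ultimately have "p \<in> carrier (Aut n E)" by (simp add: Aut_def)
    then show ?thesis by (rule bexI[rotated]) (simp add: p_def hn fh)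
  qed
  have aut_V: "f (p i) \<in> V1 \<longleftrightarrow> f i \<in> V1" and aut_n: "p i < n"
    if p: "p \<in> carrier (Aut n E)" and i: "i < n" for p i
  proof -
    have perm: "p permutes {0..<n}" and pE: "\<And>u w. \<lbrakk>u < n; w < n\<rbrakk> \<Longrightarrow> {p u, p w} \<in> E \<longleftrightarrow> {u, w} \<in> E"
      using p by (auto simp: Aut_def)
    have pn: "p j < n \<longleftrightarrow> j < n" for j using permutes_in_image[OF perm, of j] by simp
    show pi: "p i < n" using pn i by simp
    have img: "p ` {j. j < n \<and> {i, j} \<in> E} = {j. j < n \<and> {p i, j} \<in> E}"
    proof (intro equalityI subsetI)
      fix j assume j: "j \<in> {j. j < n \<and> {p i, j} \<in> E}"
      then obtain k where k: "j = p k" using permutes_surj[OF perm] by (metis surjD)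
      then show "j \<in> p ` {j. j < n \<and> {i, j} \<in> E}" using j pn pE[OF i, of k] by auto
    qed (use pn pE i in auto)
    have "card {j. j < n \<and> {p i, j} \<in> E} = card {j. j < n \<and> {i, j} \<in> E}"
      unfolding img[symmetric]
      by (rule card_image[OF inj_on_subset[OF permutes_inj[OF perm] subset_UNIV]])
    then have "card (nbrs V adj (f (p i))) = card (nbrs V adj (f i))"
      using bij_betw_same_card[OF nb[OF i]] bij_betw_same_card[OF nb[OF pi]] by simp
    then show "f (p i) \<in> V1 \<longleftrightarrow> f i \<in> V1"
      using deg1 deg2 degs fV[OF i] fV[OF pi] by (metis UnE V_def)
  qed
  have aut_V2: "f (p i) \<in> V2 \<longleftrightarrow> f i \<in> V2" if p: "p \<in> carrier (Aut n E)" and i: "i < n" for p i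
    using aut_V[OF that] fV[OF i] fV[OF aut_n[OF that]] disjoint by (auto simp: V_def)

  have "vertex_orbits n E = {h ` V1, h ` V2}"
    unfolding vertex_orbits_def
  proof (rule orbits_eqI)
    show "\<Union> {h ` V1, h ` V2} = {0..<n}" using h by (auto simp: bij_betw_def V_def)
    show "{} \<notin> {h ` V1, h ` V2}" using edge11 edge22 by auto
    fix X i assume X: "X \<in> {h ` V1, h ` V2}" "i \<in> X"
    then obtain P v where P: "P \<in> {V1, V2}" "X = h ` P" "v \<in> P" "i = h v" by auto
    then have v: "v \<in> V" by (auto simp: V_def)
    show "restrict p {0..<n} i \<in> X" if p: "p \<in> carrier (Aut n E)" for p
    proof -
      have "f (p i) \<in> P" using P aut_V[OF p] aut_V2[OF p] hn[OF v] fh[OF v] by auto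
      moreover have "p i = h (f (p i))" using aut_n[OF p hn[OF v]] P hf by simp
      ultimately show ?thesis using P hn[OF v] by auto
    qed
    show "\<exists>p\<in>carrier (Aut n E). restrict p {0..<n} i = j" if j: "j \<in> X" for j
    proof -
      obtain w where w: "w \<in> P" "j = h w" using j P by auto
      obtain g where g: "g \<in> automorphisms V adj" "g v = w" using vertex_transitive[OF P(1,3) w(1)] by auto
      then show ?thesis using aut_in[OF g(1)] P w v hn by fastforce
    qed
  qed
  moreover have "h ` V1 \<noteq> h ` V2"
  proof
    assume eq: "h ` V1 = h ` V2"
    obtain u where u: "u \<in> V1" using edge11 by auto
    then obtain w where "w \<in> V2" "h u = h w" using eq by auto
    then show False using hinj[of u w] V12 u disjoint by auto
  qed
  ultimately have vo: "card (vertex_orbits n E) = 2" by simp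

  define F where "F P Q = {{h u, h w} | u w. u \<in> P \<and> w \<in> Q \<and> adj u w}" for P Q
  have F_sub: "e \<subseteq> h ` V1" if "e \<in> F V1 V1" for e using that by (auto simp: F_def)
  have F_sub2: "e \<subseteq> h ` V2" if "e \<in> F V2 V2" for e using that by (auto simp: F_def)
  have F_mix: "e \<inter> h ` V1 \<noteq> {} \<and> e \<inter> h ` V2 \<noteq> {}" if "e \<in> F V1 V2" for e using that by (auto simp: F_def)
  have disj: "h ` V1 \<inter> h ` V2 = {}"
    using disjoint hinj V12 by (auto simp: image_iff)
  have F_I: "{h u, h w} \<in> F P Q" if "u \<in> P" "w \<in> Q" "adj u w" for u w P Q
    using that by (auto simp: F_def)
  obtain u1 w1 u2 w2 where uw1: "u1 \<in> V1" "w1 \<in> V1" "adj u1 w1"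
    and uw2: "u2 \<in> V2" "w2 \<in> V2" "adj u2 w2"
    using edge11 edge22 by auto
  obtain w3 where w3: "w3 \<in> V2" "adj u1 w3" using edge12[OF uw1(1)] by auto
  have ne: "F V1 V1 \<noteq> {}" "F V2 V2 \<noteq> {}" "F V1 V2 \<noteq> {}"
    using F_I[OF uw1] F_I[OF uw2] F_I[OF uw1(1) w3] by auto
  have nempty: "e \<noteq> {}" if "e \<in> F P Q" for e P Q using that by (auto simp: F_def)
  have "edge_orbits n E = {F V1 V1, F V1 V2, F V2 V2}"
    unfolding edge_orbits_def
  proof (rule orbits_eqI)
    show "\<Union> {F V1 V1, F V1 V2, F V2 V2} = E"
    proof (intro equalityI subsetI)
      fix e assume "e \<in> \<Union> {F V1 V1, F V1 V2, F V2 V2}"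
      then show "e \<in> E" using edge_h V12 by (auto simp: F_def)
    next
      fix e assume "e \<in> E"
      then obtain i j where e: "e = {i, j}" "i < n" "j < n" "adj (f i) (f j)" by (auto simp: E_def)
      have e': "e = {h (f i), h (f j)}" "e = {h (f j), h (f i)}" "adj (f j) (f i)"
        using e hf sym fV by auto
      have "f i \<in> V1 \<or> f i \<in> V2" "f j \<in> V1 \<or> f j \<in> V2" using fV e by (auto simp: V_def)
      then have "e \<in> F V1 V1 \<or> e \<in> F V1 V2 \<or> e \<in> F V2 V2"
        using F_I[OF _ _ e(4)] F_I[OF _ _ e'(3)] e'(1,2) by metis
      then show "e \<in> \<Union> {F V1 V1, F V1 V2, F V2 V2}" by auto
    qed
    show "{} \<notin> {F V1 V1, F V1 V2, F V2 V2}" using ne by auto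
    fix X e assume X: "X \<in> {F V1 V1, F V1 V2, F V2 V2}" "e \<in> X"
    then obtain P Q where PQ: "(P, Q) \<in> {(V1, V1), (V1, V2), (V2, V2)}" "X = F P Q" by auto
    then obtain u w where uw: "u \<in> P" "w \<in> Q" "adj u w" "e = {h u, h w}" using X by (auto simp: F_def)
    have V: "u \<in> V" "w \<in> V" using PQ uw by (auto simp: V_def)
    have eE: "e \<in> E" using uw V edge_h by simp
    show "(\<lambda>e\<in>E. p ` e) e \<in> X" if p: "p \<in> carrier (Aut n E)" for p
    proof -
      have fp: "f (p (h u)) \<in> P" "f (p (h w)) \<in> Q"
        using PQ uw V aut_V[OF p] aut_V2[OF p] hn fh by auto
      have "{p (h u), p (h w)} \<in> E" using p eE uw(4) V hn by (auto simp: Aut_def)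
      then have "adj (f (p (h u))) (f (p (h w)))" using edge aut_n[OF p] hn V by simp
      moreover have "p ` e = {h (f (p (h u))), h (f (p (h w)))}"
        using uw(4) hf aut_n[OF p] hn V by simp
      ultimately show ?thesis using F_I[OF fp] eE PQ(2) by simp
    qed
    show "\<exists>p\<in>carrier (Aut n E). (\<lambda>e\<in>E. p ` e) e = e'" if "e' \<in> X" for e'
    proof -
      obtain u' w' where uw': "u' \<in> P" "w' \<in> Q" "adj u' w'" "e' = {h u', h w'}"
        using \<open>e' \<in> X\<close> PQ(2) by (auto simp: F_def)
      obtain g where g: "g \<in> automorphisms V adj" "g u = u'" "g w = w'"
        using arc[OF PQ(1) uw(1-3) uw'(1-3)] by auto
      obtain p where p: "p \<in> carrier (Aut n E)" "\<forall>v\<in>V. p (h v) = h (g v)" using aut_in[OF g(1)] by auto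
      have "p ` e = e'" using p(2) V uw(4) uw'(4) g by simp
      then show ?thesis using p(1) eE by auto
    qed
  qed
  moreover have "e \<notin> F V1 V2" "e \<notin> F V2 V2" if "e \<in> F V1 V1" for e
    using F_sub[OF that] F_sub2[of e] F_mix[of e] nempty[OF that] disj by blast+
  moreover have "e \<notin> F V2 V2" if "e \<in> F V1 V2" for e
    using F_sub2[of e] F_mix[OF that] disj by blast
  ultimately have "edge_orbits n E = {F V1 V1, F V1 V2, F V2 V2}"
    "F V1 V1 \<noteq> F V1 V2" "F V1 V1 \<noteq> F V2 V2" "F V1 V2 \<noteq> F V2 V2"
    using ne by auto
  then have "card (edge_orbits n E) = 3" by simp
  then show ?thesis using nut vo unfolding n_def by blast
qed

end

section \<open>Joining two layers over a common base\<close>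

text \<open>The graph consists of two parts over a common base \<open>M\<close>: on \<open>M \<times> A\<close> the tensor product of
  \<open>R1\<close> and \<open>S\<close>, on \<open>M \<times> B\<close> that of \<open>R\<close> and \<open>T\<close>, and all edges between the two fibres over the
  same point of \<open>M\<close>. The parts are regular of degrees \<open>r1 * s\<close> and \<open>r * t\<close>, so the quotient
  matrix is \<open>(r1 * s, card B; card A, r * t)\<close>, and \<open>balance\<close> says that it is singular. When
  \<open>R1\<close> is the identity, the first part consists of disjoint copies of \<open>S\<close>, one over each base point.
  The last assumption makes the degrees of the two parts different: given \<open>balance\<close>, they agree only
  if \<open>r1 * s = card A\<close>.\<close>

locale layered_join =
  fixes M :: "'m set" and A :: "'a set" and B :: "'b set"
    and R1 R :: "'m \<Rightarrow> 'm \<Rightarrow> bool" and S :: "'a \<Rightarrow> 'a \<Rightarrow> bool" and T :: "'b \<Rightarrow> 'b \<Rightarrow> bool"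
    and r1 r s t :: nat
  assumes base: "arc_nonsingular M R r"
    and fibre_A: "arc_nonsingular A S s" and fibre_B: "arc_nonsingular B T t"
    and R1: "(R1 = R \<and> r1 = r) \<or> (R1 = (=) \<and> r1 = 1)"
    and loopless_B: "i \<in> M \<Longrightarrow> \<not> R i i"
    and loopless_A: "\<lbrakk>i \<in> M; u \<in> A\<rbrakk> \<Longrightarrow> \<not> (R1 i i \<and> S u u)"
    and harmonic: "\<lbrakk>\<And>i. i \<in> M \<Longrightarrow> (\<Sum>j\<in>nbrs M R i. \<Sum>k\<in>nbrs M R j. X k) = real (r * r) * X i;
        i \<in> M; j \<in> M\<rbrakk> \<Longrightarrow> X i = X j"
    and balance: "(r1 * s) * (r * t) = card A * card B"
    and unequal: "r1 * s \<noteq> card A"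
begin

sublocale base: arc_nonsingular M R r by (rule base)
sublocale A: arc_nonsingular A S s by (rule fibre_A)
sublocale B: arc_nonsingular B T t by (rule fibre_B)

abbreviation "PA \<equiv> \<lambda>p q. R1 (fst p) (fst q) \<and> S (snd p) (snd q)"
abbreviation "PB \<equiv> \<lambda>p q. R (fst p) (fst q) \<and> T (snd p) (snd q)"

lemma base1: "arc_nonsingular M R1 r1"
  using R1 base identity_arc_nonsingular[OF base.fin base.nonempty] by auto

sublocale PA: arc_nonsingular "M \<times> A" PA "r1 * s"
  by (rule arc_nonsingular_product[OF base1 fibre_A])
sublocale PB: arc_nonsingular "M \<times> B" PB "r * t"
  by (rule arc_nonsingular_product[OF base fibre_B])

definition adj :: "'m \<times> 'a + 'm \<times> 'b \<Rightarrow> 'm \<times> 'a + 'm \<times> 'b \<Rightarrow> bool" where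
  "adj p q = (case p of
      Inl x \<Rightarrow> (case q of Inl y \<Rightarrow> PA x y | Inr y \<Rightarrow> fst x = fst y)
    | Inr x \<Rightarrow> (case q of Inl y \<Rightarrow> fst x = fst y | Inr y \<Rightarrow> PB x y))"

lemma adj_simps [simp]:
  "adj (Inl x) (Inl y) = PA x y" "adj (Inl x) (Inr y') = (fst x = fst y')"
  "adj (Inr x') (Inl y) = (fst x' = fst y)" "adj (Inr x') (Inr y') = PB x' y'"
  by (simp_all add: adj_def)

definition "VA = (Inl ` (M \<times> A) :: ('m \<times> 'a + 'm \<times> 'b) set)"
definition "VB = (Inr ` (M \<times> B) :: ('m \<times> 'a + 'm \<times> 'b) set)"

lemma nbrs_Inl:
  assumes "x \<in> M \<times> A"
  shows "nbrs (VA \<union> VB) adj (Inl x) = Inl ` nbrs (M \<times> A) PA x \<union> Inr ` ({fst x} \<times> B)"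
  using assms by (auto simp: nbrs_def VA_def VB_def)

lemma nbrs_Inr:
  assumes "x \<in> M \<times> B"
  shows "nbrs (VA \<union> VB) adj (Inr x) = Inr ` nbrs (M \<times> B) PB x \<union> Inl ` ({fst x} \<times> A)"
  using assms by (auto simp: nbrs_def VA_def VB_def)

lemma sum_nbrs_Inl:
  fixes y :: "'m \<times> 'a + 'm \<times> 'b \<Rightarrow> real"
  assumes "i \<in> M" "u \<in> A"
  shows "(\<Sum>q\<in>nbrs (VA \<union> VB) adj (Inl (i, u)). y q)
    = (\<Sum>q\<in>nbrs (M \<times> A) PA (i, u). y (Inl q)) + (\<Sum>w\<in>B. y (Inr (i, w)))"
proof -
  have "(\<Sum>q\<in>nbrs (VA \<union> VB) adj (Inl (i, u)). y q)
    = (\<Sum>q\<in>Inl ` nbrs (M \<times> A) PA (i, u). y q) + (\<Sum>q\<in>Inr ` ({i} \<times> B). y q)"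
    using assms by (subst nbrs_Inl) (auto intro!: sum.union_disjoint simp: PA.finite_nbrs B.fin)
  also have "(\<Sum>q\<in>Inr ` ({i} \<times> B). y q) = (\<Sum>w\<in>B. y (Inr (i, w)))"
  proof -
    have img: "Inr ` ({i} \<times> B) = (\<lambda>w. Inr (i, w)) ` B" by auto
    show ?thesis unfolding img by (subst sum.reindex) (simp_all add: inj_on_def)
  qed
  finally show ?thesis by (simp add: sum.reindex)
qed

lemma sum_nbrs_Inr:
  fixes y :: "'m \<times> 'a + 'm \<times> 'b \<Rightarrow> real"
  assumes "i \<in> M" "u \<in> B"
  shows "(\<Sum>q\<in>nbrs (VA \<union> VB) adj (Inr (i, u)). y q)
    = (\<Sum>q\<in>nbrs (M \<times> B) PB (i, u). y (Inr q)) + (\<Sum>w\<in>A. y (Inl (i, w)))"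
proof -
  have "(\<Sum>q\<in>nbrs (VA \<union> VB) adj (Inr (i, u)). y q)
    = (\<Sum>q\<in>Inr ` nbrs (M \<times> B) PB (i, u). y q) + (\<Sum>q\<in>Inl ` ({i} \<times> A). y q)"
    using assms by (subst nbrs_Inr) (auto intro!: sum.union_disjoint simp: PB.finite_nbrs A.fin)
  also have "(\<Sum>q\<in>Inl ` ({i} \<times> A). y q) = (\<Sum>w\<in>A. y (Inl (i, w)))"
  proof -
    have img: "Inl ` ({i} \<times> A) = (\<lambda>w. Inl (i, w)) ` A" by auto
    show ?thesis unfolding img by (subst sum.reindex) (simp_all add: inj_on_def)
  qed
  finally show ?thesis by (simp add: sum.reindex)
qed

text \<open>Regularity of the fibre relation turns a sum over a fibre of neighbour sums into a neighbour sum
  over the base.\<close>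

lemma fibre_sum:
  fixes y :: "'k \<times> 'c \<Rightarrow> real"
  assumes "arc_nonsingular C Q d"
  shows "(\<Sum>u\<in>C. \<Sum>q\<in>nbrs (K \<times> C) (\<lambda>p q. L (fst p) (fst q) \<and> Q (snd p) (snd q)) (i, u). y q)
    = real d * (\<Sum>j\<in>nbrs K L i. \<Sum>w\<in>C. y (j, w))"
proof -
  interpret arc_nonsingular C Q d by (rule assms)
  have "nbrs (K \<times> C) (\<lambda>p q. L (fst p) (fst q) \<and> Q (snd p) (snd q)) (i, u) = nbrs K L i \<times> nbrs C Q u" for u
    by (auto simp: nbrs_def)
  then have "(\<Sum>u\<in>C. \<Sum>q\<in>nbrs (K \<times> C) (\<lambda>p q. L (fst p) (fst q) \<and> Q (snd p) (snd q)) (i, u). y q)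
    = (\<Sum>u\<in>C. \<Sum>j\<in>nbrs K L i. \<Sum>w\<in>nbrs C Q u. y (j, w))"
    by (simp add: sum.cartesian_product)
  also have "\<dots> = (\<Sum>j\<in>nbrs K L i. \<Sum>u\<in>C. \<Sum>w\<in>nbrs C Q u. y (j, w))" by (rule sum.swap)
  also have "\<dots> = real d * (\<Sum>j\<in>nbrs K L i. \<Sum>w\<in>C. y (j, w))"
    by (simp add: sum_sum_nbrs sum_distrib_left)
  finally show ?thesis .
qed

definition z :: "'m \<times> 'a + 'm \<times> 'b \<Rightarrow> real" where
  "z p = (case p of Inl _ \<Rightarrow> 1 | Inr _ \<Rightarrow> - real (card A) / real (r * t))"

text \<open>Summing a kernel vector over the fibres gives functions \<open>X\<close> and \<open>Y\<close> on the base with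
  \<open>s R1 X = - card A Y\<close> and \<open>t R Y = - card B X\<close>. Eliminating \<open>X\<close> and using \<open>balance\<close> leaves
  \<open>R R Y = r r Y\<close>, so \<open>Y\<close> is constant by the maximum principle. Then each part of the vector has
  constant image under a nonsingular regular relation, hence is constant.\<close>

lemma kernel_multiple:
  fixes y :: "'m \<times> 'a + 'm \<times> 'b \<Rightarrow> real"
  assumes ker: "\<And>v. v \<in> VA \<union> VB \<Longrightarrow> (\<Sum>q\<in>nbrs (VA \<union> VB) adj v. y q) = 0"
  shows "\<exists>c. \<forall>v\<in>VA \<union> VB. y v = c * z v"
proof -
  define X where "X i = (\<Sum>u\<in>A. y (Inl (i, u)))" for i
  define Y where "Y i = (\<Sum>u\<in>B. y (Inr (i, u)))" for i
  let ?a = "real (card A)" and ?b = "real (card B)"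
  have eqA: "(\<Sum>q\<in>nbrs (M \<times> A) PA (i, u). y (Inl q)) = - Y i" if "i \<in> M" "u \<in> A" for i u
    using ker[of "Inl (i, u)"] that sum_nbrs_Inl[OF that, of y] by (auto simp: Y_def VA_def)
  have eqB: "(\<Sum>q\<in>nbrs (M \<times> B) PB (i, u). y (Inr q)) = - X i" if "i \<in> M" "u \<in> B" for i u
    using ker[of "Inr (i, u)"] that sum_nbrs_Inr[OF that, of y] by (auto simp: X_def VB_def)
  have sumA: "real s * (\<Sum>j\<in>nbrs M R1 i. X j) = - ?a * Y i" if "i \<in> M" for i
    using fibre_sum[OF fibre_A, where K = M and L = R1 and i = i and y = "\<lambda>q. y (Inl q)"] eqA[OF that] by (simp add: X_def)
  have sumB: "real t * (\<Sum>j\<in>nbrs M R i. Y j) = - ?b * X i" if "i \<in> M" for i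
    using fibre_sum[OF fibre_B, where K = M and L = R and i = i and y = "\<lambda>q. y (Inr q)"] eqB[OF that] by (simp add: Y_def)
  have bal: "real (r1 * s) * real (r * t) = ?a * ?b"
    using balance by (metis of_nat_mult)
  have st: "s > 0" "t > 0" using A.pos B.pos by simp_all
  have nbrs_M: "j \<in> M" if "j \<in> nbrs M R i" for i j using that by (simp add: nbrs_def)
  have harm: "(\<Sum>j\<in>nbrs M R i. \<Sum>k\<in>nbrs M R j. Y k) = real (r * r) * Y i" if i: "i \<in> M" for i
    using R1
  proof
    assume R1: "R1 = R \<and> r1 = r"
    have "real s * real t * (\<Sum>j\<in>nbrs M R i. \<Sum>k\<in>nbrs M R j. Y k)
      = real s * (\<Sum>j\<in>nbrs M R i. real t * (\<Sum>k\<in>nbrs M R j. Y k))"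
      by (simp add: sum_distrib_left mult.assoc)
    also have "\<dots> = real s * (\<Sum>j\<in>nbrs M R i. - ?b * X j)"
      by (rule arg_cong[where f = "\<lambda>x. real s * x"], rule sum.cong[OF refl])
        (rule sumB[OF nbrs_M])
    also have "\<dots> = - ?b * (real s * (\<Sum>j\<in>nbrs M R i. X j))"
      by (subst sum_distrib_left[symmetric]) simp
    also have "\<dots> = ?a * ?b * Y i" using sumA[OF i] R1 by simp
    also have "\<dots> = real s * real t * (real (r * r) * Y i)"
      unfolding bal[symmetric] using R1 by simp
    finally show ?thesis using st by simp
  next
    assume R1: "R1 = (=) \<and> r1 = 1"
    have one: "(\<Sum>k\<in>nbrs M R j. Y k) = real r * Y j" if j: "j \<in> M" for j
    proof -
      have "nbrs M (=) j = {j}" using j by (auto simp: nbrs_def)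
      then have sX: "real s * X j = - ?a * Y j" using sumA[OF j] R1 by simp
      have "real s * real t * (\<Sum>k\<in>nbrs M R j. Y k) = real s * (- ?b * X j)"
        using sumB[OF j] by (simp add: mult.assoc)
      also have "\<dots> = - ?b * (real s * X j)" by simp
      also have "\<dots> = ?a * ?b * Y j" using sX by simp
      also have "\<dots> = real s * real t * (real r * Y j)"
        unfolding bal[symmetric] using R1 by simp
      finally show ?thesis using st by simp
    qed
    have "(\<Sum>j\<in>nbrs M R i. \<Sum>k\<in>nbrs M R j. Y k) = (\<Sum>j\<in>nbrs M R i. real r * Y j)"
      by (rule sum.cong[OF refl]) (rule one[OF nbrs_M])
    also have "\<dots> = real (r * r) * Y i" using one[OF i] by (simp flip: sum_distrib_left)
    finally show ?thesis .
  qed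
  obtain i0 where i0: "i0 \<in> M" using base.nonempty by auto
  have Yc: "Y i = Y i0" if "i \<in> M" for i by (rule harmonic[OF harm that i0])
  define c where "c = - Y i0 / real (r1 * s)"
  have xA: "y (Inl p) = c" if "p \<in> M \<times> A" for p
  proof (rule PA.constant_image[OF _ that])
    show "(\<Sum>q\<in>nbrs (M \<times> A) PA v. y (Inl q)) = real (r1 * s) * c" if "v \<in> M \<times> A" for v
      using that eqA Yc PA.pos by (auto simp: c_def)
  qed
  have Xc: "X i = ?a * c" if "i \<in> M" for i using that xA by (simp add: X_def)
  have xB: "y (Inr p) = c * (- ?a / real (r * t))" if "p \<in> M \<times> B" for p
  proof (rule PB.constant_image[OF _ that])
    show "(\<Sum>q\<in>nbrs (M \<times> B) PB v. y (Inr q)) = real (r * t) * (c * (- ?a / real (r * t)))"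
      if "v \<in> M \<times> B" for v
      using that eqB Xc PB.pos by auto
  qed
  show ?thesis using xA xB by (intro exI[of _ c]) (auto simp: VA_def VB_def z_def)
qed

lemma bij_betw_map_sum:
  "bij_betw G X Y \<Longrightarrow> bij_betw (map_sum G H) (Inl ` X) (Inl ` Y)"
  "bij_betw H X' Y' \<Longrightarrow> bij_betw (map_sum G H) (Inr ` X') (Inr ` Y')"
  by (auto simp: bij_betw_def inj_on_def image_image)

lemma automorphism:
  assumes g: "g \<in> automorphisms M R" and h: "h \<in> automorphisms A S" and k: "k \<in> automorphisms B T"
  shows "map_sum (map_prod g h) (map_prod g k) \<in> automorphisms (VA \<union> VB) adj"
proof -
  have g1: "g \<in> automorphisms M R1"
    using g R1 by (auto simp: automorphisms_def bij_betw_def inj_on_eq_iff)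
  have PA: "map_prod g h \<in> automorphisms (M \<times> A) PA" by (rule automorphisms_product[OF g1 h])
  have PB: "map_prod g k \<in> automorphisms (M \<times> B) PB" by (rule automorphisms_product[OF g k])
  let ?G = "map_sum (map_prod g h) (map_prod g k)"
  have "bij_betw ?G VA VA" "bij_betw ?G VB VB"
    unfolding VA_def VB_def
    by (intro bij_betw_map_sum; use PA PB in \<open>simp add: automorphisms_def\<close>)+
  then have "bij_betw ?G (VA \<union> VB) (VA \<union> VB)"
    by (rule bij_betw_combine) (auto simp: VA_def VB_def)
  moreover have "adj (?G p) (?G q) \<longleftrightarrow> adj p q" if "p \<in> VA \<union> VB" "q \<in> VA \<union> VB" for p q
    using that g g1 h k by (auto simp: VA_def VB_def automorphisms_def bij_betw_def inj_on_eq_iff)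
  ultimately show ?thesis by (auto simp: automorphisms_def)
qed

lemma id_automorphism: "id \<in> automorphisms W Q"
  by (simp add: automorphisms_def)

sublocale nut: two_orbit_nut "VA \<union> VB" VA VB adj "r1 * s + card B" "r * t + card A" z
proof
  show "VA \<union> VB = VA \<union> VB" by (rule refl)
  show "finite VA" "finite VB" by (simp_all add: VA_def VB_def base.fin A.fin B.fin)
  show "VA \<inter> VB = {}" by (auto simp: VA_def VB_def)
  show "\<not> adj v v" if "v \<in> VA \<union> VB" for v
    using that loopless_A loopless_B by (auto simp: VA_def VB_def)
  show "adj v u" if m: "u \<in> VA \<union> VB" "v \<in> VA \<union> VB" and a: "adj u v" for u v
  proof (cases u)
    case (Inl x)
    then show ?thesis using m a PA.sym[of x] by (cases v) (auto simp: VA_def VB_def)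
  next
    case (Inr x)
    then show ?thesis using m a PB.sym[of x] by (cases v) (auto simp: VA_def VB_def)
  qed
  show "card (nbrs (VA \<union> VB) adj v) = r1 * s + card B" if "v \<in> VA" for v
  proof -
    obtain x where x: "v = Inl x" "x \<in> M \<times> A" using \<open>v \<in> VA\<close> by (auto simp: VA_def)
    show ?thesis unfolding x(1) nbrs_Inl[OF x(2)]
      by (subst card_Un_disjoint)
        (auto simp: card_image PA.deg[OF x(2)] PA.finite_nbrs B.fin card_cartesian_product)
  qed
  show "card (nbrs (VA \<union> VB) adj v) = r * t + card A" if "v \<in> VB" for v
  proof -
    obtain x where x: "v = Inr x" "x \<in> M \<times> B" using \<open>v \<in> VB\<close> by (auto simp: VB_def)
    show ?thesis unfolding x(1) nbrs_Inr[OF x(2)]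
      by (subst card_Un_disjoint)
        (auto simp: card_image PB.deg[OF x(2)] PB.finite_nbrs A.fin card_cartesian_product)
  qed
  show "r1 * s + card B \<noteq> r * t + card A"
  proof
    assume eq: "r1 * s + card B = r * t + card A"
    define p q a b where "p = int (r1 * s)" "q = int (r * t)" "a = int (card A)" "b = int (card B)"
    have "p + b = q + a" "p * q = a * b"
      using eq balance unfolding p_q_a_b_def by (metis of_nat_add, metis of_nat_mult)
    have "(p - a) * (p + b) = p * (p + b) - a * p - a * b" by (simp add: algebra_simps)
    also have "\<dots> = p * (q + a) - a * p - p * q" by (simp only: \<open>p + b = q + a\<close> \<open>p * q = a * b\<close>)
    also have "\<dots> = 0" by (simp add: algebra_simps)
    finally have "(p - a) * (p + b) = 0" .
    moreover have "p > 0" "b \<ge> 0" "p \<noteq> a"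
      using PA.pos unequal unfolding p_q_a_b_def by (simp_all only: of_nat_eq_iff) simp_all
    ultimately show False by simp
  qed
  show "z v \<noteq> 0" if "v \<in> VA \<union> VB" for v
    using that PB.pos A.nonempty A.fin by (auto simp: VA_def VB_def z_def)
  show "(\<Sum>w\<in>nbrs (VA \<union> VB) adj v. z w) = 0" if "v \<in> VA \<union> VB" for v
    using that
  proof
    assume "v \<in> VA"
    then obtain i u where v: "v = Inl (i, u)" "i \<in> M" "u \<in> A" by (auto simp: VA_def)
    have "real (r1 * s) * real (r * t) = real (card A) * real (card B)"
      using balance by (metis of_nat_mult)
    then have "real (r1 * s) = real (card B) * (real (card A) / real (r * t))"
      using PB.pos by (simp add: field_simps)
    then show ?thesis using v sum_nbrs_Inl[OF v(2,3), of z] PA.deg[of "(i, u)"]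
      by (simp add: z_def)
  next
    assume "v \<in> VB"
    then obtain i u where v: "v = Inr (i, u)" "i \<in> M" "u \<in> B" by (auto simp: VB_def)
    show ?thesis using v sum_nbrs_Inr[OF v(2,3), of z] PB.deg[of "(i, u)"] base.pos B.pos
      by (simp add: z_def)
  qed
  show "\<exists>c. \<forall>v\<in>VA \<union> VB. y v = c * z v"
    if "\<And>v. v \<in> VA \<union> VB \<Longrightarrow> (\<Sum>w\<in>nbrs (VA \<union> VB) adj v. y w) = 0" for y
    by (rule kernel_multiple[OF that])
  obtain p where p: "p \<in> M \<times> A" using base.nonempty A.nonempty by auto
  obtain q where "q \<in> M \<times> A" "PA p q" using PA.neighbour[OF p] by blast
  then show "\<exists>u\<in>VA. \<exists>w\<in>VA. adj u w"
    using p by (intro bexI[of _ "Inl p"] bexI[of _ "Inl q"]) (auto simp: VA_def)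
  obtain p' where p': "p' \<in> M \<times> B" using base.nonempty B.nonempty by auto
  obtain q' where "q' \<in> M \<times> B" "PB p' q'" using PB.neighbour[OF p'] by blast
  then show "\<exists>u\<in>VB. \<exists>w\<in>VB. adj u w"
    using p' by (intro bexI[of _ "Inr p'"] bexI[of _ "Inr q'"]) (auto simp: VB_def)
  show "\<exists>w\<in>VB. adj u w" if "u \<in> VA" for u
    using that B.nonempty by (auto simp: VA_def VB_def)
  show "\<exists>u\<in>VA. adj u w" if "w \<in> VB" for w
    using that A.nonempty by (auto simp: VA_def VB_def)
  show "\<exists>G\<in>automorphisms (VA \<union> VB) adj. G u = u' \<and> G w = w'"
    if PQ: "(P, Q) \<in> {(VA, VA), (VA, VB), (VB, VB)}" and uw: "u \<in> P" "w \<in> Q" "adj u w"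
      and uw': "u' \<in> P" "w' \<in> Q" "adj u' w'" for P Q u w u' w'
  proof -
    have R1_arc: "\<exists>g\<in>automorphisms M R. g i = i' \<and> g j = j'"
      if "i \<in> M" "j \<in> M" "R1 i j" "i' \<in> M" "j' \<in> M" "R1 i' j'" for i j i' j'
      using R1 base.arc[of i j i' j'] base.vertex_transitive[of i i'] that by auto
    consider "P = VA" "Q = VA" | "P = VA" "Q = VB" | "P = VB" "Q = VB" using PQ by auto
    then show ?thesis
    proof cases
      case 1
      then obtain i a j b i' a' j' b' where
        e: "u = Inl (i, a)" "w = Inl (j, b)" "u' = Inl (i', a')" "w' = Inl (j', b')"
        and mem: "i \<in> M" "j \<in> M" "i' \<in> M" "j' \<in> M" "a \<in> A" "b \<in> A" "a' \<in> A" "b' \<in> A"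
        using uw uw' by (auto simp: VA_def)
      obtain g where g: "g \<in> automorphisms M R" "g i = i'" "g j = j'"
        using R1_arc[of i j i' j'] uw uw' e mem by auto
      obtain h where h: "h \<in> automorphisms A S" "h a = a'" "h b = b'"
        using A.arc[of a b a' b'] uw uw' e mem by auto
      show ?thesis by (rule bexI[OF _ automorphism[OF g(1) h(1) id_automorphism]]) (simp add: e g h)
    next
      case 2
      then obtain i a b i' a' b' where
        e: "u = Inl (i, a)" "w = Inr (i, b)" "u' = Inl (i', a')" "w' = Inr (i', b')"
        and mem: "i \<in> M" "i' \<in> M" "a \<in> A" "b \<in> B" "a' \<in> A" "b' \<in> B"
        using uw uw' by (auto simp: VA_def VB_def)
      obtain g where g: "g \<in> automorphisms M R" "g i = i'"
        using base.vertex_transitive mem by auto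
      obtain h where h: "h \<in> automorphisms A S" "h a = a'"
        using A.vertex_transitive mem by auto
      obtain k where k: "k \<in> automorphisms B T" "k b = b'"
        using B.vertex_transitive mem by auto
      show ?thesis by (rule bexI[OF _ automorphism[OF g(1) h(1) k(1)]]) (simp add: e g h k)
    next
      case 3
      then obtain i a j b i' a' j' b' where
        e: "u = Inr (i, a)" "w = Inr (j, b)" "u' = Inr (i', a')" "w' = Inr (j', b')"
        and mem: "i \<in> M" "j \<in> M" "i' \<in> M" "j' \<in> M" "a \<in> B" "b \<in> B" "a' \<in> B" "b' \<in> B"
        using uw uw' by (auto simp: VB_def)
      obtain g where g: "g \<in> automorphisms M R" "g i = i'" "g j = j'"
        using base.arc[of i j i' j'] uw uw' e mem by auto
      obtain k where k: "k \<in> automorphisms B T" "k a = a'" "k b = b'"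
        using B.arc[of a b a' b'] uw uw' e mem by auto
      show ?thesis by (rule bexI[OF _ automorphism[OF g(1) id_automorphism k(1)]]) (simp add: e g k)
    qed
  qed
qed

lemma card_vertices: "card (VA \<union> VB) = card M * (card A + card B)"
proof -
  have "card (VA \<union> VB) = card VA + card VB"
    by (rule card_Un_disjoint) (auto simp: VA_def VB_def base.fin A.fin B.fin)
  then show ?thesis
    by (simp add: VA_def VB_def card_image card_cartesian_product distrib_left)
qed

end

section \<open>Admissible orders\<close>

text \<open>The final construction depends on its ingredients only through their sizes and degrees.
  The natural numbers and the integers serve as a supply of vertices; the base lives on integers
  because the circulants do.\<close>

definition fibre :: "nat \<Rightarrow> nat \<Rightarrow> bool" where
  "fibre a s \<longleftrightarrow> (\<exists>(V :: nat set) S. arc_nonsingular V S s \<and> card V = a)"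

definition loopless_fibre :: "nat \<Rightarrow> nat \<Rightarrow> bool" where
  "loopless_fibre a s \<longleftrightarrow>
     (\<exists>(V :: nat set) S. arc_nonsingular V S s \<and> card V = a \<and> (\<forall>u\<in>V. \<not> S u u))"

definition base :: "nat \<Rightarrow> nat \<Rightarrow> bool" where
  "base m r \<longleftrightarrow> (\<exists>(M :: int set) R. arc_nonsingular M R r \<and> card M = m \<and> (\<forall>i\<in>M. \<not> R i i) \<and>
     (\<forall>i\<in>M. \<forall>j\<in>M. (\<lambda>i k. \<exists>j\<in>nbrs M R i. k \<in> nbrs M R j)\<^sup>*\<^sup>* i j))"

lemma loopless_imp_fibre: "loopless_fibre a s \<Longrightarrow> fibre a s"
  by (auto simp: fibre_def loopless_fibre_def)

lemma loopless_fibreI: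
  assumes "arc_nonsingular V S s" "card V = a" "\<And>u. u \<in> V \<Longrightarrow> \<not> S u u"
  shows "loopless_fibre a s"
proof -
  interpret arc_nonsingular V S s by fact
  obtain g where g: "bij_betw g {0..<card V} V" using ex_bij_betw_nat_finite[OF fin] by blast
  show ?thesis
    unfolding loopless_fibre_def
    by (intro exI conjI, rule transport[OF g])
      (use assms(2,3) g in \<open>auto simp: bij_betw_def\<close>)
qed

lemma fibreI:
  assumes "arc_nonsingular V S s" "card V = a"
  shows "fibre a s"
proof -
  interpret arc_nonsingular V S s by fact
  obtain g where g: "bij_betw g {0..<card V} V" using ex_bij_betw_nat_finite[OF fin] by blast
  show ?thesis
    unfolding fibre_def by (intro exI conjI, rule transport[OF g]) (use assms(2) in auto)
qed

lemma fibre_product: "\<lbrakk>fibre a s; fibre b t\<rbrakk> \<Longrightarrow> fibre (a * b) (s * t)"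
  unfolding fibre_def[of a] fibre_def[of b]
  by (auto intro!: fibreI[OF arc_nonsingular_product] simp: card_cartesian_product)

lemma loopless_fibre_product:
  assumes "loopless_fibre a s" "fibre b t" shows "loopless_fibre (a * b) (s * t)"
proof -
  obtain V :: "nat set" and S where V: "arc_nonsingular V S s" "card V = a" "\<forall>u\<in>V. \<not> S u u"
    using assms(1) by (auto simp: loopless_fibre_def)
  obtain W :: "nat set" and T where W: "arc_nonsingular W T t" "card W = b"
    using assms(2) by (auto simp: fibre_def)
  show ?thesis
    by (rule loopless_fibreI[OF arc_nonsingular_product[OF V(1) W(1)]])
      (use V W in \<open>auto simp: card_cartesian_product\<close>)
qed

lemma fibre_identity: "a \<ge> 1 \<Longrightarrow> fibre a 1"
  by (rule fibreI[OF identity_arc_nonsingular[of "{0..<a}"]]) auto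

lemma loopless_fibre_complete: "a \<ge> 2 \<Longrightarrow> loopless_fibre a (a - 1)"
  using loopless_fibreI[OF complete_arc_nonsingular[of "{0..<a}"], of a] by simp

lemma loopless_fibre_cycle:
  assumes "a \<ge> 3" "odd a" shows "loopless_fibre a 2"
  by (rule loopless_fibreI[OF cycle_arc_nonsingular[of "int a"]])
    (use assms in \<open>auto simp: circulant_def\<close>)

lemma loopless_fibre_kneser:
  assumes "v \<ge> 5" shows "loopless_fibre (v * (v - 1) div 2) ((v - 2) * (v - 3) div 2)"
proof (rule loopless_fibreI)
  show "arc_nonsingular {e. e \<subseteq> {0..<v} \<and> card e = 2} (\<lambda>e f. e \<inter> f = {}) ((v - 2) * (v - 3) div 2)"
    using kneser_arc_nonsingular(1)[OF assms] by (simp add: choose_two)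
  show "card {e. e \<subseteq> {0..<v} \<and> card e = 2} = v * (v - 1) div 2"
    using kneser_arc_nonsingular(2)[OF assms] by (simp add: choose_two)
qed auto

lemma loopless_fibre_rook:
  assumes "k \<ge> 3" shows "loopless_fibre (k * k) (2 * (k - 1))"
  by (rule loopless_fibreI[OF rook_arc_nonsingular[OF assms]]) (auto simp: card_cartesian_product)

lemma loopless_fibre_cubic: "loopless_fibre 19 6"
  by (rule loopless_fibreI[OF cubic_residues_19]) (auto simp: circulant_def)

lemma base_circulant:
  assumes "circulant_group m H" "odd m" "arc_nonsingular {0..<m} (circulant m H) r" "0 \<notin> H"
  shows "base (nat m) r"
  unfolding base_def
  by (rule exI[of _ "{0..<m}"], rule exI[of _ "circulant m H"])
    (use assms circulant_group.two_step_connected[OF assms(1,2)] in \<open>auto simp: circulant_def\<close>)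

lemma base_cycle: "\<lbrakk>m \<ge> 3; odd m\<rbrakk> \<Longrightarrow> base m 2"
  using base_circulant[OF cycle_group[of "int m"] _ cycle_arc_nonsingular[of "int m"]] by auto

lemma base_complete:
  assumes "m \<ge> 3" shows "base m (m - 1)"
  unfolding base_def
proof (intro exI conjI ballI)
  show "arc_nonsingular {0..<int m} (\<noteq>) (m - 1)"
    using complete_arc_nonsingular[of "{0..<int m}"] assms by simp
  show "(\<lambda>i k. \<exists>j\<in>nbrs {0..<int m} (\<noteq>) i. k \<in> nbrs {0..<int m} (\<noteq>) j)\<^sup>*\<^sup>* i k"
    if "i \<in> {0..<int m}" "k \<in> {0..<int m}" for i k
  proof (rule r_into_rtranclp)
    have "card {i, k} < card {0..<int m}" using assms by (auto simp: card_insert_if)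
    then obtain j where "j \<in> {0..<int m}" "j \<notin> {i, k}"
      by (metis card_mono finite.emptyI finite_insert leD subsetI)
    then show "\<exists>j\<in>nbrs {0..<int m} (\<noteq>) i. k \<in> nbrs {0..<int m} (\<noteq>) j"
      using that by (auto simp: nbrs_def)
  qed
qed auto

text \<open>13 and 55 are odd square roots of \<open>-1\<close> modulo 17 and 89.\<close>

lemma base_quartic: "base 17 4" "base 89 4"
  using base_circulant[OF quartic_circulant_arc_nonsingular(1) _ quartic_circulant_arc_nonsingular(2),
      of 17 13] base_circulant[OF quartic_circulant_arc_nonsingular(1) _ quartic_circulant_arc_nonsingular(2),
      of 89 55] by simp_all

definition two_three_nut :: "nat \<Rightarrow> bool" where
  "two_three_nut n \<longleftrightarrow>
     (\<exists>E. nut_graph n E \<and> card (vertex_orbits n E) = 2 \<and> card (edge_orbits n E) = 3)"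

lemma baseE:
  assumes "base m r"
  obtains M :: "int set" and R where "arc_nonsingular M R r" "card M = m" "\<And>i. i \<in> M \<Longrightarrow> \<not> R i i"
    "\<And>X i j. \<lbrakk>\<And>i. i \<in> M \<Longrightarrow> (\<Sum>j\<in>nbrs M R i. \<Sum>k\<in>nbrs M R j. X k) = real (r * r) * X i;
       i \<in> M; j \<in> M\<rbrakk> \<Longrightarrow> X i = X j"
proof -
  obtain M :: "int set" and R where M: "arc_nonsingular M R r" "card M = m" "\<forall>i\<in>M. \<not> R i i"
    "\<forall>i\<in>M. \<forall>j\<in>M. (\<lambda>i k. \<exists>j\<in>nbrs M R i. k \<in> nbrs M R j)\<^sup>*\<^sup>* i j"
    using assms unfolding base_def by blast
  show ?thesis
  proof (rule that[OF M(1,2)])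
    show "\<not> R i i" if "i \<in> M" for i using M(3) that by blast
    show "X i = X j"
      if "\<And>i. i \<in> M \<Longrightarrow> (\<Sum>j\<in>nbrs M R i. \<Sum>k\<in>nbrs M R j. X k) = real (r * r) * X i" "i \<in> M" "j \<in> M"
      for X i j
    proof (rule arc_nonsingular.harmonic_constant[OF M(1) that(1) _ that(2,3)])
      fix i j assume "i \<in> M" "j \<in> M"
      then show "(\<lambda>i k. \<exists>j\<in>nbrs M R i. k \<in> nbrs M R j)\<^sup>*\<^sup>* i j" using M(4) by blast
    qed
  qed
qed

lemma nut_of_layers:
  assumes "base m r" "fibre a s" "fibre b t" "(r * s) * (r * t) = a * b" "r * s \<noteq> a"
  shows "two_three_nut (m * (a + b))"
proof -
  obtain M :: "int set" and R where M: "arc_nonsingular M R r" "card M = m" "\<And>i. i \<in> M \<Longrightarrow> \<not> R i i"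
    "\<And>X i j. \<lbrakk>\<And>i. i \<in> M \<Longrightarrow> (\<Sum>j\<in>nbrs M R i. \<Sum>k\<in>nbrs M R j. X k) = real (r * r) * X i;
       i \<in> M; j \<in> M\<rbrakk> \<Longrightarrow> X i = X j"
    using baseE[OF assms(1)] by blast
  obtain A :: "nat set" and S where A: "arc_nonsingular A S s" "card A = a"
    using assms(2) unfolding fibre_def by blast
  obtain B :: "nat set" and T where B: "arc_nonsingular B T t" "card B = b"
    using assms(3) unfolding fibre_def by blast
  interpret layered_join M A B "R" R S T r r s t
    by (rule layered_join.intro[OF M(1) A(1) B(1) _ M(3) _ M(4)]) (use M(3) A B(2) assms(4,5) in simp_all)
  show ?thesis
    using nut.realise unfolding two_three_nut_def card_vertices M(2) A(2) B(2) .
qed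

lemma nut_of_loopless_layers:
  assumes "base m r" "loopless_fibre a s" "fibre b t" "s * (r * t) = a * b" "s \<noteq> a"
  shows "two_three_nut (m * (a + b))"
proof -
  obtain M :: "int set" and R where M: "arc_nonsingular M R r" "card M = m" "\<And>i. i \<in> M \<Longrightarrow> \<not> R i i"
    "\<And>X i j. \<lbrakk>\<And>i. i \<in> M \<Longrightarrow> (\<Sum>j\<in>nbrs M R i. \<Sum>k\<in>nbrs M R j. X k) = real (r * r) * X i;
       i \<in> M; j \<in> M\<rbrakk> \<Longrightarrow> X i = X j"
    using baseE[OF assms(1)] by blast
  obtain A :: "nat set" and S where A: "arc_nonsingular A S s" "card A = a" "\<forall>u\<in>A. \<not> S u u"
    using assms(2) unfolding loopless_fibre_def by blast
  obtain B :: "nat set" and T where B: "arc_nonsingular B T t" "card B = b"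
    using assms(3) unfolding fibre_def by blast
  interpret layered_join M A B "(=)" R S T 1 r s t
    by (rule layered_join.intro[OF M(1) A(1) B(1) _ M(3) _ M(4)]) (use M(3) A B(2) assms(4,5) in simp_all)
  show ?thesis
    using nut.realise unfolding two_three_nut_def card_vertices M(2) A(2) B(2) .
qed

text \<open>Over a cycle the construction works for every odd length at once.\<close>

definition multiplier :: "nat \<Rightarrow> bool" where
  "multiplier q \<longleftrightarrow> (\<forall>m. m \<ge> 3 \<longrightarrow> odd m \<longrightarrow> two_three_nut (m * q))"

lemma multiplierI:
  assumes "fibre a s" "fibre b t" "4 * s * t = a * b" "2 * s \<noteq> a"
  shows "multiplier (a + b)"
  using nut_of_layers[OF base_cycle assms(1,2)] assms(3,4) by (simp add: multiplier_def)

lemma multiplier_looplessI: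
  assumes "loopless_fibre a s" "fibre b t" "2 * s * t = a * b" "s \<noteq> a"
  shows "multiplier (a + b)"
  using nut_of_loopless_layers[OF base_cycle assms(1,2)] assms(3,4) by (simp add: multiplier_def mult.left_commute)

lemmas ident = fibre_identity
lemmas compl_loopless = loopless_fibre_complete
lemmas compl = compl_loopless[THEN loopless_imp_fibre]
lemmas kneser = loopless_fibre_kneser[THEN loopless_imp_fibre]
lemmas rook = loopless_fibre_rook[of 4, THEN loopless_imp_fibre]
lemmas cubic = loopless_fibre_cubic[THEN loopless_imp_fibre]

text \<open>The entries solve \<open>4 s t = a b\<close> or \<open>2 s t = a b\<close> with \<open>a + b\<close> the prime in question: one needs
  two regular relations whose densities \<open>s / a\<close> and \<open>t / b\<close> multiply to \<open>1 / 4\<close> or \<open>1 / 2\<close>.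
  Complete graphs and identities have densities \<open>(k - 1) / k\<close> and \<open>1 / k\<close>, and densities multiply
  under tensor products.\<close>

lemma multipliers:
  "multiplier 3" "multiplier 5" "multiplier 7" "multiplier 11" "multiplier 13" "multiplier 19"
  "multiplier 29" "multiplier 31" "multiplier 37" "multiplier 41" "multiplier 43" "multiplier 47"
  "multiplier 53" "multiplier 59" "multiplier 61" "multiplier 71" "multiplier 73" "multiplier 79"
  "multiplier 83" "multiplier 101" "multiplier 103" "multiplier 109" "multiplier 127"
  "multiplier 131" "multiplier 137" "multiplier 139"
proof -
  show "multiplier 3"
    using multiplier_looplessI[of 2 1 1 1] compl_loopless[of 2] ident[of 1]
    by simp
  show "multiplier 5"
    using multiplierI[of 1 1 4 1] ident[of 1] ident[of 4]
    by simp
  show "multiplier 7"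
    using multiplierI[of 3 1 4 3] ident[of 3] compl[of 4]
    by simp
  show "multiplier 11"
    using multiplierI[of 3 2 8 3] compl[of 3] fibre_product[OF ident[of 2] compl[of 4]]
    by simp
  show "multiplier 13"
    using multiplierI[of 1 1 12 3] ident[of 1] fibre_product[OF ident[of 3] compl[of 4]]
    by simp
  show "multiplier 19"
    using multiplierI[of 3 2 16 6] compl[of 3] rook
    by simp
  show "multiplier 29"
    using multiplierI[of 8 7 21 6] compl[of 8] fibre_product[OF ident[of 3] compl[of 7]]
    by simp
  show "multiplier 31"
    using multiplierI[of 7 6 24 7] compl[of 7] fibre_product[OF ident[of 3] compl[of 8]]
    by simp
  show "multiplier 37"
    using multiplierI[of 16 7 21 12] fibre_product[OF ident[of 2] compl[of 8]]
      fibre_product[OF compl[of 3] compl[of 7]]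
    by simp
  show "multiplier 41"
    using multiplierI[of 9 8 32 9] compl[of 9]
      fibre_product[OF ident[of 2] fibre_product[OF compl[of 4] compl[of 4]]]
    by simp
  show "multiplier 43"
    using multiplier_looplessI[of 7 6 36 21] compl_loopless[of 7] kneser[of 9]
    by simp
  show "multiplier 47"
    using multiplierI[of 15 8 32 15] fibre_product[OF compl[of 3] compl[of 5]]
      fibre_product[OF ident[of 2] compl[of 16]]
    by simp
  show "multiplier 53"
    using multiplierI[of 5 4 48 15] compl[of 5] fibre_product[OF ident[of 3] compl[of 16]]
    by simp
  show "multiplier 59"
    using multiplierI[of 3 1 56 42] ident[of 3] fibre_product[OF compl[of 7] compl[of 8]]
    by simp
  show "multiplier 61"
    using multiplierI[of 1 1 60 15] ident[of 1] fibre_product[OF compl[of 6] kneser[of 5]]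
    by simp
  show "multiplier 71"
    using multiplierI[of 15 14 56 15] compl[of 15] fibre_product[OF ident[of 2] kneser[of 8]]
    by simp
  show "multiplier 73"
    using multiplierI[of 9 8 64 18] compl[of 9] fibre_product[OF compl[of 4] rook]
    by simp
  show "multiplier 79"
    using multiplierI[of 7 6 72 21] compl[of 7] fibre_product[OF ident[of 2] kneser[of 9]]
    by simp
  show "multiplier 83"
    using multiplierI[of 3 1 80 60] ident[of 3] fibre_product[OF compl[of 5] compl[of 16]]
    by simp
  show "multiplier 101"
    using multiplierI[of 5 4 96 30] compl[of 5]
      fibre_product[OF ident[of 2] fibre_product[OF compl[of 3] compl[of 16]]]
    by simp
  show "multiplier 103"
    using multiplier_looplessI[of 48 33 55 40]
      loopless_fibre_product[OF compl_loopless[of 4] compl[of 12]]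
      fibre_product[OF compl[of 5] compl[of 11]]
    by simp
  show "multiplier 109"
    using multiplierI[of 45 16 64 45]
      fibre_product[OF compl[of 3] fibre_product[OF compl[of 3] compl[of 5]]]
      fibre_product[OF compl[of 4] compl[of 16]]
    by simp
  show "multiplier 127"
    using multiplierI[of 63 48 64 21] fibre_product[OF compl[of 7] compl[of 9]]
      fibre_product[OF ident[of 2] fibre_product[OF compl[of 4] compl[of 8]]]
    by simp
  show "multiplier 131"
    using multiplierI[of 35 24 96 35] fibre_product[OF compl[of 5] compl[of 7]]
      fibre_product[OF ident[of 2] fibre_product[OF compl[of 6] compl[of 8]]]
    by simp
  show "multiplier 137"
    using multiplier_looplessI[of 32 21 105 80]
      loopless_fibre_product[OF compl_loopless[of 4] compl[of 8]]
      fibre_product[OF compl[of 5] compl[of 21]]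
    by simp
  show "multiplier 139"
    using multiplierI[of 19 6 120 95] cubic fibre_product[OF compl[of 6] compl[of 20]]
    by simp
qed

text \<open>The primes 17, 23, 67, 89, 97, 107 and 113 have no entry in the list above, and the products
  needed for them use bases of larger degree: quartic circulants here, the complete graph on 23
  points below.\<close>

lemma nut_17_times:
  "two_three_nut (17 * 17)" "two_three_nut (17 * 23)" "two_three_nut (17 * 67)" "two_three_nut (17 * 89)"
  "two_three_nut (17 * 97)" "two_three_nut (17 * 107)" "two_three_nut (17 * 113)"
proof -
  show "two_three_nut (17 * 17)"
    using nut_of_layers[OF base_quartic(1) ident[of 1] ident[of 16]] by simp
  show "two_three_nut (17 * 23)"
    using nut_of_layers[OF base_quartic(1) ident[of 7] fibre_product[OF ident[of 2] compl[of 8]]] by simp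
  show "two_three_nut (17 * 67)"
    using nut_of_layers[OF base_quartic(1) compl[of 3] fibre_product[OF ident[of 4] rook]] by simp
  show "two_three_nut (17 * 89)"
    using nut_of_layers[OF base_quartic(2) ident[of 1] ident[of 16]] by simp
  show "two_three_nut (17 * 97)"
    using nut_of_layers[OF base_quartic(1) ident[of 1] fibre_product[OF ident[of 6] rook]] by simp
  show "two_three_nut (17 * 107)"
    using nut_of_layers[OF base_quartic(1) loopless_fibre_cycle[THEN loopless_imp_fibre, of 11]
        fibre_product[OF ident[of 2] fibre_product[OF compl[of 4] compl[of 12]]]] by simp
  show "two_three_nut (17 * 113)"
    using nut_of_layers[OF base_quartic(1) ident[of 1] fibre_product[OF ident[of 14] compl[of 8]]] by simp
qed

lemma nut_23_times:
  "two_three_nut (23 * 23)" "two_three_nut (23 * 67)" "two_three_nut (23 * 89)" "two_three_nut (23 * 97)"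
  "two_three_nut (23 * 107)"
proof -
  have base: "base 23 22" using base_complete[of 23] by simp
  show "two_three_nut (23 * 23)"
    using nut_of_loopless_layers[OF base loopless_fibre_product[OF compl_loopless[of 2] ident[of 11]] ident[of 1]] by simp
  show "two_three_nut (23 * 67)"
    using nut_of_loopless_layers[OF base loopless_fibre_product[OF compl_loopless[of 4] ident[of 3]]
      fibre_product[OF ident[of 5] compl[of 11]]] by simp
  show "two_three_nut (23 * 89)"
    using nut_of_loopless_layers[OF base loopless_fibre_product[OF compl_loopless[of 3] ident[of 11]]
      fibre_product[OF compl[of 7] compl[of 8]]] by simp
  show "two_three_nut (23 * 97)"
    using nut_of_loopless_layers[OF base compl_loopless[of 33] fibre_product[OF ident[of 16] compl[of 4]]] by simp
  show "two_three_nut (23 * 107)"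
    using nut_of_loopless_layers[OF base loopless_fibre_product[OF compl_loopless[of 22] ident[of 2]]
      fibre_product[OF ident[of 9] compl[of 7]]] by simp
qed

lemma multiplier_dvd:
  assumes "multiplier q" "q dvd d" "odd (d * k)" "k \<ge> 3" shows "two_three_nut (d * k)"
proof -
  obtain c where c: "d = q * c" using assms(2) by (elim dvdE)
  then have "c \<noteq> 0" using assms(3) by (intro notI) simp
  then have "c * k \<ge> 1 * 3" using assms(4) by (intro mult_le_mono) auto
  moreover have "odd (c * k)" using assms(3) c by simp
  ultimately have "two_three_nut (c * k * q)" using assms(1) by (simp add: multiplier_def)
  then show ?thesis using c by (simp add: ac_simps)
qed

theorem mainTheorem6:
  fixes n :: nat
  assumes "odd n" and "\<not> prime n" and "9 \<le> n" and "n \<le> 2500"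
  shows "\<exists>E. nut_graph n E \<and> card (vertex_orbits n E) = 2 \<and> card (edge_orbits n E) = 3"
proof -
  have dvd: "two_three_nut (d * k)" if "\<exists>q. multiplier q \<and> q dvd d" "odd (d * k)" "k \<ge> 3" for d k
    using that multiplier_dvd by blast
  obtain d k where n: "n = d * k" "d \<le> k" "1 < d"
  proof -
    obtain a where a: "a dvd n" "a \<noteq> 1" "a \<noteq> n"
      using assms(2,3) by (auto simp: prime_nat_iff)
    then obtain b where b: "n = a * b" by (elim dvdE)
    then have ab: "n = a * b" "1 < a" "1 < b" using a assms(3) by (auto intro!: Suc_lessI Nat.gr0I)
    then show ?thesis using that[of a b] that[of b a] by (cases "a \<le> b") (simp_all add: mult.commute)
  qed
  have odd: "odd d" "odd k" using assms(1) n(1) by auto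
  have "d \<le> 50"
  proof (rule ccontr)
    assume "\<not> d \<le> 50"
    then have "51 * 51 \<le> d * k" using n(2) by (intro mult_le_mono) auto
    then show False using n(1) assms(4) by simp
  qed
  have "d \<ge> 3" "k \<ge> 3" using n odd by presburger+
  have "two_three_nut n"
  proof (cases "d = 17 \<or> d = 23")
    case False
    have "d \<in> {3, 5, 7, 9, 11, 13, 15, 17, 19, 21, 23, 25, 27, 29, 31, 33, 35, 37,
            39, 41, 43, 45, 47, 49}"
      using \<open>odd d\<close> \<open>d \<le> 50\<close> \<open>d \<ge> 3\<close> by simp presburger
    then have "\<exists>q\<in>{3, 5, 7, 11, 13, 19, 29, 31, 37, 41, 43, 47}. q dvd d"
      using False by (elim insertE emptyE) simp_all
    then have "\<exists>q. multiplier q \<and> q dvd d" using multipliers by blast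
    then show ?thesis unfolding n(1) using odd \<open>k \<ge> 3\<close> by (intro dvd) auto
  next
    case True
    show ?thesis
    proof (cases "\<exists>q. multiplier q \<and> q dvd k")
      case True
      then show ?thesis using dvd[of k d] odd \<open>d \<ge> 3\<close> n(1) by (simp add: mult.commute)
    next
      case False
      then have no: "\<not> q dvd k" if "multiplier q" for q using that by blast
      have k: "k < 148" "17 \<le> k" "d = 23 \<Longrightarrow> k < 109" using True n assms(4) by auto
      have "k \<in> {17, 23, 67, 89, 97, 107, 113} \<or> (\<exists>q\<in>{3, 5, 7, 11, 13, 19, 29, 31, 37, 41, 43, 47, 53, 59, 61, 71, 73, 79,
            83, 101, 103, 109, 127, 131, 137, 139}. q dvd k)"
      proof -
        have "k \<in> {17, 19, 21, 23, 25, 27, 29, 31, 33, 35, 37, 39, 41, 43, 45, 47, 49,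
            51, 53, 55, 57, 59, 61, 63, 65, 67, 69, 71, 73, 75, 77, 79, 81, 83,
            85, 87, 89, 91, 93, 95, 97, 99, 101, 103, 105, 107, 109, 111, 113,
            115, 117, 119, 121, 123, 125, 127, 129, 131, 133, 135, 137, 139, 141,
            143, 145, 147}"
          using odd(2) k(1,2) by simp presburger
        then show ?thesis by (elim insertE emptyE) simp_all
      qed
      moreover have "\<not> (\<exists>q\<in>{3, 5, 7, 11, 13, 19, 29, 31, 37, 41, 43, 47, 53, 59, 61, 71, 73, 79,
            83, 101, 103, 109, 127, 131, 137, 139}. q dvd k)"
        using no multipliers by blast
      ultimately have "k \<in> {17, 23, 67, 89, 97, 107, 113}" by blast
      moreover have "k \<noteq> 17 \<and> k \<noteq> 113" if "d = 23" using that k(3) n(2) by auto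
      ultimately show ?thesis using True nut_17_times nut_23_times unfolding n(1) by auto
    qed
  qed
  then show ?thesis by (simp add: two_three_nut_def)
qed

end
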